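(* Assume conditions (M) and (CC). Suppose that $\emptyset\in\Psi$, $\mathsf P\in\mathcal H_0$, and let the detection subsystems be selected such that $$\min_{e\in\mathcal K}\mathcal I(\mathsf P,\mathcal G_{\Psi,e};s_e)=\min_{e\in\mathcal K}\mathcal I(\mathsf P,\mathcal G_{\Psi,e})$$ (which is trivially the case when $s_e=[K]$ for every $e\in\mathcal K$). Then, as $\alpha,\beta\to0$, $$\mathsf E_{\mathsf P}[T^*_{det}]\sim\max_{e\in\mathcal K}\Big\{\frac{|\log\beta|}{\mathcal I(\mathsf P,\mathcal G_{\Psi,e})}\Big\}\sim\inf\{\mathsf E_{\mathsf P}[T]:(T,D)\in\mathcal D_\Psi(\alpha,\beta)\};$$ as $\alpha,\beta\to0$, while $\gamma$ and $\delta$ are either fixed or go to $0$, $$\mathsf E_{\mathsf P}[T^*]\sim\max_{e\in\mathcal K}\Big\{\frac{|\log\beta|}{\mathcal I(\mathsf P,\mathcal G_{\Psi,e})}\Big\}\sim\inf\{\mathsf E_{\mathsf P}[T]:(T,D)\in\mathcal C_\Psi(\alpha,\beta,\gamma,\delta)\};$$ and, as $\gamma,\delta\to0$, $$\mathsf E_{\mathsf P}[T^*_{fwer}]\sim\max_{e\in\mathcal K}\Big\{\frac{|\log\delta|}{\mathcal I(\mathsf P,\mathcal G_{\Psi,e})}\Big\}\sim\inf\{\mathsf E_{\mathsf P}[T]:(T,D)\in\mathcal E_\Psi(\gamma,\delta)\}.$$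
   Context: Setting. There are $K$ data sources, $[K]=\{1,\dots,K\}$; $X_n^k$ is the random element observed from source $k$ at time $n\in\mathbb N=\{1,2,\dots\}$. For $s\subseteq[K]$: $X_n^s=\{X_n^k:k\in s\}$, $X^s=\{X_n^s:n\in\mathbb N\}$, $\mathcal F_n^s=\sigma(X_1^s,\dots,X_n^s)$; the superscript is omitted when $s=[K]$. $\mathcal P$ is a finite family of distributions of $X$; $\mathsf P^s$ is the law of $X^s$ under $\mathsf P$, and $\mathcal Q^s=\{\mathsf P^s:\mathsf P\in\mathcal Q\}$. $\mathcal K$ is a finite family of subsets of $[K]$ (units). For each $e\in\mathcal K$, $\mathcal H^e$ and $\mathcal G^e$ are nonempty disjoint subfamilies of $\mathcal P^e$; $\mathcal A(\mathsf P)=\{e\in\mathcal K:\mathsf P^e\in\mathcal G^e\}$. $\Psi$ is a family of subsets of $\mathcal K$, and $\mathcal P_\Psi=\{\mathsf P\in\mathcal P:\mathsf P^e\in\mathcal H^e\cup\mathcal G^e\ \forall e\in\mathcal K,\ \mathcal A(\mathsf P)\in\Psi\}$, $\mathcal H_0=\{\mathsf P\in\mathcal P:\mathsf P^e\in\mathcal H^e\ \forall e\}$, $\mathcal H_{\Psi,e}=\{\mathsf P\in\mathcal P_\Psi\setminus\mathcal H_0:e\notin\mathcal A(\mathsf P)\}$, $\mathcal G_{\Psi,e}=\{\mathsf P\in\mathcal P_\Psi:e\in\mathcal A(\mathsf P)\}$. Standing assumption: for every $e\in\mathcal K$, $\mathsf P\in\mathcal G_{\Psi,e}\cup\mathcal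 H_0$, $\mathsf Q\in\mathcal H_{\Psi,e}\cup\mathcal H_0$, $e\subseteq s\subseteq[K]$, $n\in\mathbb N$, $\mathsf P^s,\mathsf Q^s$ are mutually absolutely continuous on $\mathcal F_n^s$; $\Lambda_n(\mathsf P^s,\mathsf Q^s)=\frac{d\mathsf P^s}{d\mathsf Q^s}(\mathcal F_n^s)$, $Z_n=\log\Lambda_n$. Conditions (M) and (CC): for every $e\in\mathcal K$, $\mathsf P\in\mathcal G_{\Psi,e}$, $\mathsf Q\in\mathcal H_{\Psi,e}\cup\mathcal H_0$, $e\subseteq s\subseteq[K]$ there are positive numbers $\mathcal I(\mathsf P^s,\mathsf Q^s)$, $\mathcal I(\mathsf Q^s,\mathsf P^s)$ such that: (M) as $n\to\infty$, $\mathsf P(\max_{1\le m\le n}Z_m(\mathsf P^s,\mathsf Q^s)\ge n\rho)\to0$ for all $\rho>\mathcal I(\mathsf P^s,\mathsf Q^s)$ and $\mathsf Q(\max_{1\le m\le n}Z_m(\mathsf Q^s,\mathsf P^s)\ge n\rho)\to0$ for all $\rho>\mathcal I(\mathsf Q^s,\mathsf P^s)$; (CC) $\sum_{n\ge1}\mathsf P(Z_n(\mathsf P^s,\mathsf Q^s)<n\rho)<\infty$ for all $\rho<\mathcal I(\mathsf P^s,\mathsf Q^s)$ and $\sum_{n\ge1}\mathsf Q(Z_n(\mathsf Q^s,\mathsf P^s)<n\rho)<\infty$ for all $\rho<\mathcal I(\mathsf Q^s,\mathsf P^s)$. Notation: $\mathcal I(\mathsf P,\mathsf Q;s)=\mathcal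 I(\mathsf P^s,\mathsf Q^s)$, $\mathcal I(\mathsf P,\mathcal Q;s)=\min_{\mathsf Q\in\mathcal Q}\mathcal I(\mathsf P,\mathsf Q;s)$; $s$ is omitted when $s=[K]$. Statistics. Each unit has a detection subsystem $s_e$ and an isolation subsystem $s'_e$, $e\subseteq s_e\cap s'_e$, $s_e,s_e'\subseteq[K]$; $$\Lambda_{e,\rm det}(n)=\frac{\max\{\Lambda_n(\mathsf P,\mathsf P_0):\mathsf P\in\mathcal G_{\Psi,e}^{s_e}\}}{\max\{\Lambda_n(\mathsf P,\mathsf P_0):\mathsf P\in\mathcal H_0^{s_e}\}},\qquad \Lambda_{e,\rm iso}(n)=\frac{\max\{\Lambda_n(\mathsf P,\mathsf P_0'):\mathsf P\in\mathcal G_{\Psi,e}^{s'_e}\}}{\max\{\Lambda_n(\mathsf P,\mathsf P_0'):\mathsf P\in\mathcal H_{\Psi,e}^{s'_e}\}},$$ $\mathsf P_0\in\mathcal H_0^{s_e}$, $\mathsf P_0'\in\mathcal H_0^{s'_e}$ arbitrary (families over which maxima are taken are tacitly nonempty); $D_{\rm iso}(n)=\{e:\Lambda_{e,\rm iso}(n)>1\}$. Test classes. A test is $(T,D)$ with $T$ an $\{\mathcal F_n\}$-stopping time, $D$ $\mathcal F_T$-measurable and $\Psi$-valued. $\mathcal D_\Psi(\alpha,\beta)$: $\mathsf P(D\ne\emptyset)\le\alpha$ on $\mathcal H_0$, $\mathsf P(D=\emptyset)\le\beta$ on $\mathcal P_\Psi\setminus\mathcal H_0$. $\mathcal E_\Psi(\gamma,\delta)$: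 $\mathsf P(D\setminus\mathcal A(\mathsf P)\ne\emptyset)\le\gamma$, $\mathsf P(\mathcal A(\mathsf P)\setminus D\ne\emptyset)\le\delta$ on $\mathcal P_\Psi$. $\mathcal C_\Psi(\alpha,\beta,\gamma,\delta)$: tests in $\mathcal D_\Psi(\alpha,\beta)$ with $\mathsf P(D\setminus\mathcal A(\mathsf P)\ne\emptyset)\le\gamma$, $\mathsf P(\mathcal A(\mathsf P)\setminus D\ne\emptyset,D\ne\emptyset)\le\delta$ on $\mathcal P_\Psi\setminus\mathcal H_0$. Procedures ($\emptyset\in\Psi$): $T_0=\inf\{n:\Lambda_{e,\rm det}(n)\le1/C_e\ \forall e\}$; $T_{det}=\inf\{n:\Lambda_{e,\rm det}(n)\ge D_e\text{ for some }e\}$; $T_{joint}=\inf\{n:\Lambda_{e,\rm det}(n)\ge D_e\text{ for some }e,\ \Lambda_{e,\rm iso}(n)\notin(1/A_e,B_e)\ \forall e,\ D_{\rm iso}(n)\in\Psi\setminus\{\emptyset\}\}$. $\chi^*_{det}$: $T^*_{det}=T_0\wedge T_{det}$, $D^*_{det}=\emptyset$ iff $T_0<T_{det}$. $\chi^*$: $T^*=T_0\wedge T_{joint}$, $D^*=\emptyset$ if $T_0<T_{joint}$, $D^*=D_{\rm iso}(T^* )$ if $T_{joint}<T_0$. $\chi^*_{fwer}=(T^*_{fwer},D^*_{fwer})$: $\chi^*$ with $C_e=A_e$, $D_e=B_e$ for all $e$. Thresholds are functions of the levels in $(0,1)$ such that $\chi^*_{det}\in\mathcal D_\Psi(\alpha,\beta)$,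 $\chi^*_{fwer}\in\mathcal E_\Psi(\gamma,\delta)$, $\chi^*\in\mathcal C_\Psi(\alpha,\beta,\gamma,\delta)$ for all levels, and for every $e$: $\log A_e\sim|\log\delta|$, $\log B_e\sim|\log\gamma|$, $\log C_e\sim|\log\beta|$, $\log D_e\sim|\log\alpha|$ as the corresponding levels go to $0$ (for $\chi^*_{fwer}$ only the relations for $A_e,B_e$ apply). $x\sim y$ means $x/y\to1$. *)

theory Defs
  imports "HOL-Probability.Probability" "HOL-Library.Landau_Symbols"
begin

text \<open>
  Sources are the numbers \<open>1, \<dots>, K\<close> and times are \<open>1, 2, \<dots>\<close>.  The probability space is the
  canonical one: an outcome is a path \<open>x\<close>, with \<open>x (n, k)\<close> the element observed from source \<open>k\<close> at
  time \<open>n\<close>, and a distribution of \<open>X\<close> is a probability measure on the space of all paths.  The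
  sources may have different measurable spaces \<open>S k\<close>, all carried by one type.
\<close>

type_synonym 'x path = "nat \<times> nat \<Rightarrow> 'x"

definition path_space :: "(nat \<Rightarrow> 'x measure) \<Rightarrow> nat set \<Rightarrow> 'x path measure" where
  "path_space S s = PiM ({1..} \<times> s) (\<lambda>(n, k). S k)"

definition restrict_sources :: "nat set \<Rightarrow> 'x path \<Rightarrow> 'x path" where
  "restrict_sources s x = restrict x ({1..} \<times> s)"

text \<open>
  \<open>obs_filtration S s (enat n)\<close> is the \<open>\<sigma>\<close>-algebra generated by the observations of the sources
  in \<open>s\<close> up to time \<open>n\<close>, and at \<open>\<infinity>\<close> it is the one generated by all of them.  The index type is
  \<open>enat\<close> because stopping times may be infinite.
\<close>

definition obs_filtration :: "(nat \<Rightarrow> 'x measure) \<Rightarrow> nat set \<Rightarrow> enat \<Rightarrow> 'x path measure" where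
  "obs_filtration S s t =
     (let J = {m. 1 \<le> m \<and> enat m \<le> t} \<times> s
      in vimage_algebra (space (path_space S s)) (\<lambda>x. restrict x J) (PiM J (\<lambda>(m, k). S k)))"

definition law :: "(nat \<Rightarrow> 'x measure) \<Rightarrow> nat set \<Rightarrow> 'x path measure \<Rightarrow> 'x path measure" where
  "law S s P = distr P (path_space S s) (restrict_sources s)"

text \<open>The following two take as arguments laws on the path space of the sources in \<open>s\<close>.\<close>

definition law_upto ::
    "(nat \<Rightarrow> 'x measure) \<Rightarrow> nat set \<Rightarrow> nat \<Rightarrow> 'x path measure \<Rightarrow> 'x path measure" where
  "law_upto S s n \<mu> = restr_to_subalg \<mu> (obs_filtration S s (enat n))"

text \<open>
  \<open>RN_deriv N M\<close> is a density of \<open>M\<close> with respect to \<open>N\<close>, so \<open>LR S s n \<mu> \<nu>\<close> is \<open>d\<mu>/d\<nu>\<close>.  It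
  restricts its last argument, so that it can be applied to a path of all sources.
\<close>

definition LR ::
    "(nat \<Rightarrow> 'x measure) \<Rightarrow> nat set \<Rightarrow> nat \<Rightarrow> 'x path measure \<Rightarrow> 'x path measure \<Rightarrow> 'x path \<Rightarrow> real" where
  "LR S s n \<mu> \<nu> x =
     enn2real (RN_deriv (law_upto S s n \<nu>) (law_upto S s n \<mu>) (restrict_sources s x))"

definition LLR ::
    "(nat \<Rightarrow> 'x measure) \<Rightarrow> nat set \<Rightarrow> nat \<Rightarrow> 'x path measure \<Rightarrow> 'x path measure \<Rightarrow> 'x path \<Rightarrow> real" where
  "LLR S s n \<mu> \<nu> x = ln (LR S s n \<mu> \<nu> x)"

text \<open>
  The fields are: the number of sources, the observation space of each source, the family of
  distributions of \<open>X\<close>, the units, the families \<open>H\<^sup>e\<close> and \<open>G\<^sup>e\<close>, the family \<open>\<Psi>\<close>, the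
  detection and isolation subsystems, and the reference laws in the denominators of the likelihood
  ratios of the detection and isolation statistics.
\<close>

record 'x setting =
  nsources :: nat
  obs :: "nat \<Rightarrow> 'x measure"
  dists :: "'x path measure set"
  units :: "nat set set"
  Hfam :: "nat set \<Rightarrow> 'x path measure set"
  Gfam :: "nat set \<Rightarrow> 'x path measure set"
  Psi :: "nat set set set"
  sdet :: "nat set \<Rightarrow> nat set"
  siso :: "nat set \<Rightarrow> nat set"
  refdet :: "nat set \<Rightarrow> 'x path measure"
  refiso :: "nat set \<Rightarrow> 'x path measure"

definition sources :: "'x setting \<Rightarrow> nat set" where
  "sources M = {1..nsources M}"

definition full_space :: "'x setting \<Rightarrow> 'x path measure" where
  "full_space M = path_space (obs M) (sources M)"

definition anomalous :: "'x setting \<Rightarrow> 'x path measure \<Rightarrow> nat set set" where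
  "anomalous M P = {e \<in> units M. law (obs M) e P \<in> Gfam M e}"

definition P_Psi :: "'x setting \<Rightarrow> 'x path measure set" where
  "P_Psi M = {P \<in> dists M.
     (\<forall>e\<in>units M. law (obs M) e P \<in> Hfam M e \<union> Gfam M e) \<and> anomalous M P \<in> Psi M}"

definition H_null :: "'x setting \<Rightarrow> 'x path measure set" where
  "H_null M = {P \<in> dists M. \<forall>e\<in>units M. law (obs M) e P \<in> Hfam M e}"

definition H_Psi :: "'x setting \<Rightarrow> nat set \<Rightarrow> 'x path measure set" where
  "H_Psi M e = {P \<in> P_Psi M - H_null M. e \<notin> anomalous M P}"

definition G_Psi :: "'x setting \<Rightarrow> nat set \<Rightarrow> 'x path measure set" where
  "G_Psi M e = {P \<in> P_Psi M. e \<in> anomalous M P}"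

definition mutually_abs_cont :: "'x setting \<Rightarrow> bool" where
  "mutually_abs_cont M \<longleftrightarrow>
     (\<forall>e\<in>units M. \<forall>P \<in> G_Psi M e \<union> H_null M. \<forall>Q \<in> H_Psi M e \<union> H_null M.
      \<forall>s. e \<subseteq> s \<and> s \<subseteq> sources M \<longrightarrow> (\<forall>n\<ge>1.
        absolutely_continuous (law_upto (obs M) s n (law (obs M) s P))
                              (law_upto (obs M) s n (law (obs M) s Q)) \<and>
        absolutely_continuous (law_upto (obs M) s n (law (obs M) s Q))
                              (law_upto (obs M) s n (law (obs M) s P))))"

text \<open>
  The nonemptiness conditions are those needed for the maxima and minima over these families and
  over the units to make sense.
\<close>

definition valid_setting :: "'x setting \<Rightarrow> bool" where
  "valid_setting M \<longleftrightarrow>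
     finite (dists M) \<and>
     (\<forall>P\<in>dists M. prob_space P \<and> sets P = sets (full_space M)) \<and>
     units M \<noteq> {} \<and> (\<forall>e\<in>units M. e \<subseteq> sources M) \<and>
     (\<forall>e\<in>units M.
        Hfam M e \<subseteq> law (obs M) e ` dists M \<and> Gfam M e \<subseteq> law (obs M) e ` dists M \<and>
        Hfam M e \<noteq> {} \<and> Gfam M e \<noteq> {} \<and> Hfam M e \<inter> Gfam M e = {}) \<and>
     Psi M \<subseteq> Pow (units M) \<and>
     mutually_abs_cont M \<and>
     (\<forall>e\<in>units M. e \<subseteq> sdet M e \<inter> siso M e \<and> sdet M e \<subseteq> sources M \<and> siso M e \<subseteq> sources M) \<and>
     H_null M \<noteq> {} \<and> (\<forall>e\<in>units M. G_Psi M e \<noteq> {} \<and> H_Psi M e \<noteq> {}) \<and>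
     (\<forall>e\<in>units M. refdet M e \<in> law (obs M) (sdet M e) ` H_null M \<and>
                  refiso M e \<in> law (obs M) (siso M e) ` H_null M)"

text \<open>
  In the next three definitions \<open>I \<mu> \<nu>\<close> is the information number of a pair of laws on the path space
  of a common set of sources.
\<close>

definition info_positive ::
    "'x setting \<Rightarrow> ('x path measure \<Rightarrow> 'x path measure \<Rightarrow> real) \<Rightarrow> bool" where
  "info_positive M I \<longleftrightarrow>
     (\<forall>e\<in>units M. \<forall>P \<in> G_Psi M e. \<forall>Q \<in> H_Psi M e \<union> H_null M. \<forall>s. e \<subseteq> s \<and> s \<subseteq> sources M \<longrightarrow>
        0 < I (law (obs M) s P) (law (obs M) s Q) \<and> 0 < I (law (obs M) s Q) (law (obs M) s P))"

definition condition_M ::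
    "'x setting \<Rightarrow> ('x path measure \<Rightarrow> 'x path measure \<Rightarrow> real) \<Rightarrow> bool" where
  "condition_M M I \<longleftrightarrow>
     (\<forall>e\<in>units M. \<forall>P \<in> G_Psi M e. \<forall>Q \<in> H_Psi M e \<union> H_null M. \<forall>s. e \<subseteq> s \<and> s \<subseteq> sources M \<longrightarrow>
        (let Ps = law (obs M) s P; Qs = law (obs M) s Q in
          (\<forall>\<rho> > I Ps Qs. (\<lambda>n. measure P {x \<in> space P.
              Max ((\<lambda>m. LLR (obs M) s m Ps Qs x) ` {1..n}) \<ge> real n * \<rho>}) \<longlonglongrightarrow> 0) \<and>
          (\<forall>\<rho> > I Qs Ps. (\<lambda>n. measure Q {x \<in> space Q.
              Max ((\<lambda>m. LLR (obs M) s m Qs Ps x) ` {1..n}) \<ge> real n * \<rho>}) \<longlonglongrightarrow> 0)))"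

definition condition_CC ::
    "'x setting \<Rightarrow> ('x path measure \<Rightarrow> 'x path measure \<Rightarrow> real) \<Rightarrow> bool" where
  "condition_CC M I \<longleftrightarrow>
     (\<forall>e\<in>units M. \<forall>P \<in> G_Psi M e. \<forall>Q \<in> H_Psi M e \<union> H_null M. \<forall>s. e \<subseteq> s \<and> s \<subseteq> sources M \<longrightarrow>
        (let Ps = law (obs M) s P; Qs = law (obs M) s Q in
          (\<forall>\<rho> < I Ps Qs. summable (\<lambda>n. measure P {x \<in> space P.
              LLR (obs M) s (Suc n) Ps Qs x < real (Suc n) * \<rho>})) \<and>
          (\<forall>\<rho> < I Qs Ps. summable (\<lambda>n. measure Q {x \<in> space Q.
              LLR (obs M) s (Suc n) Qs Ps x < real (Suc n) * \<rho>}))))"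

definition min_info ::
    "'x setting \<Rightarrow> ('x path measure \<Rightarrow> 'x path measure \<Rightarrow> real) \<Rightarrow>
     'x path measure \<Rightarrow> 'x path measure set \<Rightarrow> nat set \<Rightarrow> real" where
  "min_info M I P \<Q> s = Min ((\<lambda>Q. I (law (obs M) s P) (law (obs M) s Q)) ` \<Q>)"

definition Lambda_det :: "'x setting \<Rightarrow> nat set \<Rightarrow> nat \<Rightarrow> 'x path \<Rightarrow> real" where
  "Lambda_det M e n x =
     Max ((\<lambda>\<mu>. LR (obs M) (sdet M e) n \<mu> (refdet M e) x) ` (law (obs M) (sdet M e) ` G_Psi M e)) /
     Max ((\<lambda>\<mu>. LR (obs M) (sdet M e) n \<mu> (refdet M e) x) ` (law (obs M) (sdet M e) ` H_null M))"

definition Lambda_iso :: "'x setting \<Rightarrow> nat set \<Rightarrow> nat \<Rightarrow> 'x path \<Rightarrow> real" where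
  "Lambda_iso M e n x =
     Max ((\<lambda>\<mu>. LR (obs M) (siso M e) n \<mu> (refiso M e) x) ` (law (obs M) (siso M e) ` G_Psi M e)) /
     Max ((\<lambda>\<mu>. LR (obs M) (siso M e) n \<mu> (refiso M e) x) ` (law (obs M) (siso M e) ` H_Psi M e))"

definition D_iso :: "'x setting \<Rightarrow> nat \<Rightarrow> 'x path \<Rightarrow> nat set set" where
  "D_iso M n x = {e \<in> units M. Lambda_iso M e n x > 1}"

type_synonym thresholds = "nat set \<Rightarrow> real"
type_synonym 'x test = "('x path \<Rightarrow> enat) \<times> ('x path \<Rightarrow> nat set set)"

text \<open>
  The infimum of the empty set is \<open>\<infinity>\<close>.
\<close>

definition T_null :: "'x setting \<Rightarrow> thresholds \<Rightarrow> 'x path \<Rightarrow> enat" where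
  "T_null M C x = Inf {enat n | n. 1 \<le> n \<and> (\<forall>e\<in>units M. Lambda_det M e n x \<le> 1 / C e)}"

definition T_det :: "'x setting \<Rightarrow> thresholds \<Rightarrow> 'x path \<Rightarrow> enat" where
  "T_det M D x = Inf {enat n | n. 1 \<le> n \<and> (\<exists>e\<in>units M. Lambda_det M e n x \<ge> D e)}"

definition T_joint ::
    "'x setting \<Rightarrow> thresholds \<Rightarrow> thresholds \<Rightarrow> thresholds \<Rightarrow> 'x path \<Rightarrow> enat" where
  "T_joint M A B D x = Inf {enat n | n. 1 \<le> n \<and>
     (\<exists>e\<in>units M. Lambda_det M e n x \<ge> D e) \<and>
     (\<forall>e\<in>units M. Lambda_iso M e n x \<notin> {1 / A e <..< B e}) \<and>
     D_iso M n x \<in> Psi M - {{}}}"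

definition T_det_star :: "'x setting \<Rightarrow> thresholds \<Rightarrow> thresholds \<Rightarrow> 'x path \<Rightarrow> enat" where
  "T_det_star M C D x = min (T_null M C x) (T_det M D x)"

definition T_star ::
    "'x setting \<Rightarrow> thresholds \<Rightarrow> thresholds \<Rightarrow> thresholds \<Rightarrow> thresholds \<Rightarrow> 'x path \<Rightarrow> enat" where
  "T_star M A B C D x = min (T_null M C x) (T_joint M A B D x)"

text \<open>
  The decisions of the procedures are only partly prescribed (the detection procedure does not
  specify which nonempty set it selects, the joint one says nothing when both times coincide, e.g.
  when both are infinite), so these are predicates on decisions rather than definitions of them.
\<close>

definition is_det_decision ::
    "'x setting \<Rightarrow> thresholds \<Rightarrow> thresholds \<Rightarrow> ('x path \<Rightarrow> nat set set) \<Rightarrow> bool" where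
  "is_det_decision M C D d \<longleftrightarrow>
     (\<forall>x\<in>space (full_space M). d x = {} \<longleftrightarrow> T_null M C x < T_det M D x)"

definition is_joint_decision ::
    "'x setting \<Rightarrow> thresholds \<Rightarrow> thresholds \<Rightarrow> thresholds \<Rightarrow> thresholds \<Rightarrow>
     ('x path \<Rightarrow> nat set set) \<Rightarrow> bool" where
  "is_joint_decision M A B C D d \<longleftrightarrow>
     (\<forall>x\<in>space (full_space M).
        (T_null M C x < T_joint M A B D x \<longrightarrow> d x = {}) \<and>
        (T_joint M A B D x < T_null M C x \<longrightarrow> d x = D_iso M (the_enat (T_star M A B C D x)) x))"

definition is_test :: "'x setting \<Rightarrow> 'x test \<Rightarrow> bool" where
  "is_test M Td \<longleftrightarrow> (case Td of (T, d) \<Rightarrow>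
     stopping_time (obs_filtration (obs M) (sources M)) T \<and>
     (\<forall>x\<in>space (full_space M). 1 \<le> T x) \<and>
     d \<in> measurable
           (filtration.pre_sigma (space (full_space M)) (obs_filtration (obs M) (sources M)) T)
           (count_space (Psi M)))"

definition class_D :: "'x setting \<Rightarrow> real \<Rightarrow> real \<Rightarrow> 'x test set" where
  "class_D M \<alpha> \<beta> = {(T, d). is_test M (T, d) \<and>
     (\<forall>P \<in> H_null M. measure P {x \<in> space P. d x \<noteq> {}} \<le> \<alpha>) \<and>
     (\<forall>P \<in> P_Psi M - H_null M. measure P {x \<in> space P. d x = {}} \<le> \<beta>)}"

definition class_E :: "'x setting \<Rightarrow> real \<Rightarrow> real \<Rightarrow> 'x test set" where
  "class_E M \<gamma> \<delta> = {(T, d). is_test M (T, d) \<and>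
     (\<forall>P \<in> P_Psi M.
        measure P {x \<in> space P. d x - anomalous M P \<noteq> {}} \<le> \<gamma> \<and>
        measure P {x \<in> space P. anomalous M P - d x \<noteq> {}} \<le> \<delta>)}"

definition class_C :: "'x setting \<Rightarrow> real \<Rightarrow> real \<Rightarrow> real \<Rightarrow> real \<Rightarrow> 'x test set" where
  "class_C M \<alpha> \<beta> \<gamma> \<delta> = {(T, d). (T, d) \<in> class_D M \<alpha> \<beta> \<and>
     (\<forall>P \<in> P_Psi M - H_null M.
        measure P {x \<in> space P. d x - anomalous M P \<noteq> {}} \<le> \<gamma> \<and>
        measure P {x \<in> space P. anomalous M P - d x \<noteq> {} \<and> d x \<noteq> {}} \<le> \<delta>)}"

definition expected_time :: "'x path measure \<Rightarrow> ('x path \<Rightarrow> enat) \<Rightarrow> ennreal" where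
  "expected_time P T = (\<integral>\<^sup>+ x. ennreal_of_enat (T x) \<partial>P)"

text \<open>
  \<open>enn2real\<close> sends \<open>\<infinity>\<close> to \<open>0\<close>; an asymptotic equivalence of such values with a positive function
  still entails that the expectations are eventually finite.
\<close>

definition ET :: "'x path measure \<Rightarrow> ('x path \<Rightarrow> enat) \<Rightarrow> real" where
  "ET P T = enn2real (expected_time P T)"

definition optimal_ET :: "'x path measure \<Rightarrow> 'x test set \<Rightarrow> real" where
  "optimal_ET P \<C> = enn2real (INF (T, d) \<in> \<C>. expected_time P T)"

definition max_ratio ::
    "'x setting \<Rightarrow> ('x path measure \<Rightarrow> 'x path measure \<Rightarrow> real) \<Rightarrow> 'x path measure \<Rightarrow> real \<Rightarrow> real" where
  "max_ratio M I P b = Max ((\<lambda>e. \<bar>ln b\<bar> / min_info M I P (G_Psi M e) (sources M)) ` units M)"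

text \<open>A level that goes to \<open>0\<close>, or one that stays fixed in the unit interval.\<close>

definition level_regime :: "real filter \<Rightarrow> bool" where
  "level_regime F \<longleftrightarrow> F = at_right 0 \<or> (\<exists>c\<in>{0<..<1}. F = principal {c})"

abbreviation levels2 :: "(real \<times> real) filter" where
  "levels2 \<equiv> at_right 0 \<times>\<^sub>F at_right 0"

abbreviation levels4 :: "real filter \<Rightarrow> real filter \<Rightarrow> (real \<times> real \<times> real \<times> real) filter" where
  "levels4 F\<gamma> F\<delta> \<equiv> at_right 0 \<times>\<^sub>F at_right 0 \<times>\<^sub>F F\<gamma> \<times>\<^sub>F F\<delta>"

lemma filtration_obs_filtration:
  "filtration (space (path_space S s)) (obs_filtration S s)"
proof
  show "space (obs_filtration S s t) = space (path_space S s)" for t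
    by (simp add: obs_filtration_def Let_def)
next
  fix t u :: enat
  assume tu: "t \<le> u"
  define J where "J v = {m. 1 \<le> m \<and> enat m \<le> v} \<times> s" for v
  define \<Omega> where "\<Omega> = space (path_space S s)"
  have JJ: "J t \<subseteq> J u"
    using tu by (auto simp: J_def intro: order_trans)
  have JI: "J u \<subseteq> {1..} \<times> s"
    by (auto simp: J_def)
  have in_u: "(\<lambda>x. restrict x (J u)) \<in> \<Omega> \<rightarrow> space (PiM (J u) (\<lambda>(m, k). S k))"
    using JI by (auto simp: \<Omega>_def path_space_def space_PiM PiE_iff)
  have "(\<lambda>x. restrict x (J u)) \<in>
      vimage_algebra \<Omega> (\<lambda>x. restrict x (J u)) (PiM (J u) (\<lambda>(m, k). S k)) \<rightarrow>\<^sub>M PiM (J u) (\<lambda>(m, k). S k)"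
    by (rule measurable_vimage_algebra1[OF in_u])
  moreover have "(\<lambda>y. restrict y (J t)) \<in>
      PiM (J u) (\<lambda>(m, k). S k) \<rightarrow>\<^sub>M PiM (J t) (\<lambda>(m, k). S k)"
    by (rule measurable_restrict_subset[OF JJ])
  ultimately have "(\<lambda>x. restrict (restrict x (J u)) (J t)) \<in>
      vimage_algebra \<Omega> (\<lambda>x. restrict x (J u)) (PiM (J u) (\<lambda>(m, k). S k)) \<rightarrow>\<^sub>M PiM (J t) (\<lambda>(m, k). S k)"
    by (rule measurable_compose)
  moreover have "restrict (restrict x (J u)) (J t) = restrict x (J t)" for x :: "'a path"
    using JJ by (simp add: Int_absorb1)
  ultimately have meas: "(\<lambda>x. restrict x (J t)) \<in>
      vimage_algebra \<Omega> (\<lambda>x. restrict x (J u)) (PiM (J u) (\<lambda>(m, k). S k)) \<rightarrow>\<^sub>M PiM (J t) (\<lambda>(m, k). S k)"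
    by simp
  have "sets (vimage_algebra \<Omega> (\<lambda>x. restrict x (J t)) (PiM (J t) (\<lambda>(m, k). S k))) \<subseteq>
        sets (vimage_algebra \<Omega> (\<lambda>x. restrict x (J u)) (PiM (J u) (\<lambda>(m, k). S k)))"
    by (rule sets_image_in_sets[OF _ meas]) simp
  then show "sets (obs_filtration S s t) \<subseteq> sets (obs_filtration S s u)"
    by (simp add: obs_filtration_def Let_def J_def \<Omega>_def)
qed

end

theory Submission
  imports Defs
begin

text \<open>
  Under a null distribution \<open>P\<close> the expected sample sizes are determined by how long it takes to
  rule out every alternative, and the error level that governs this is the one of missed
  detections.  Write \<open>b\<close> for it and \<open>J\<close> for the smallest information number of \<open>P\<close> against an
  alternative, over all units; then \<open>max_ratio\<close> is \<open>\<bar>ln b\<bar> / J\<close>.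

  \<^emph>\<open>Lower bound.\<close>  Let \<open>Q\<close> be an alternative at which \<open>J\<close> is attained.  A test with small error
  levels decides for the null with probability close to \<open>1\<close> under \<open>P\<close>, but at most \<open>b\<close> under \<open>Q\<close>.  Such
  a discrepancy requires a likelihood ratio of order \<open>1 / b\<close> at the time of stopping, and by condition
  (M) the log-likelihood ratio grows no faster than \<open>J\<close> per observation.  Hence stopping substantially
  before \<open>\<bar>ln b\<bar> / J\<close> has vanishing probability, uniformly over all tests
  (\<open>class_D_early_stopping_bound\<close>, \<open>class_D_expected_time_lower\<close>).

  \<^emph>\<open>Upper bound.\<close>  Every procedure stops no later than the null rule \<open>T_null\<close>, and that rule has
  stopped once \<open>P\<close> dominates each alternative, on each detection subsystem, by the factor \<open>C e\<close>
  (\<open>Lambda_det_le_inverse\<close>).  The logarithm of this factor is about \<open>\<bar>ln b\<bar>\<close>.  At a rate just below the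
  smallest information number of the subsystems, which equals \<open>J\<close> by assumption, complete convergence
  bounds the expected number of times at which domination fails, so that the expected delay beyond
  \<open>\<bar>ln b\<bar> / J\<close> is a constant (\<open>null_time_bound\<close>, \<open>null_time_expected_upper\<close>).

  The joint classes of tests consist of detection tests, with levels \<open>\<alpha>\<close>, \<open>\<beta>\<close> in one case and \<open>\<gamma>\<close>, \<open>\<delta>\<close>
  in the other, so that the same two bounds settle all three procedures (\<open>first_order_optimality\<close>).
\<close>

section \<open>Densities\<close>

lemma RN_deriv_chain:
  assumes fin: "sigma_finite_measure \<kappa>" "sigma_finite_measure \<nu>"
    and sets: "sets \<nu> = sets \<kappa>" "sets \<mu> = sets \<kappa>"
    and ac: "absolutely_continuous \<kappa> \<nu>" "absolutely_continuous \<nu> \<mu>"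
  shows "AE x in \<kappa>. RN_deriv \<kappa> \<mu> x = RN_deriv \<kappa> \<nu> x * RN_deriv \<nu> \<mu> x"
proof -
  interpret \<kappa>: sigma_finite_measure \<kappa> by fact
  interpret \<nu>: sigma_finite_measure \<nu> by fact
  have [measurable]: "RN_deriv \<nu> \<mu> \<in> borel_measurable \<kappa>"
    using borel_measurable_RN_deriv[of \<nu> \<mu>] measurable_cong_sets[OF sets(1) refl] by blast
  have "density \<kappa> (\<lambda>x. RN_deriv \<kappa> \<nu> x * RN_deriv \<nu> \<mu> x)
      = density (density \<kappa> (RN_deriv \<kappa> \<nu>)) (RN_deriv \<nu> \<mu>)"
    by (simp add: density_density_eq)
  also have "\<dots> = density \<nu> (RN_deriv \<nu> \<mu>)"
    by (simp add: \<kappa>.density_RN_deriv ac sets)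
  also have "\<dots> = \<mu>"
    by (simp add: \<nu>.density_RN_deriv ac sets)
  finally have "AE x in \<kappa>. RN_deriv \<kappa> \<nu> x * RN_deriv \<nu> \<mu> x = RN_deriv \<kappa> \<mu> x"
    by (intro \<kappa>.RN_deriv_unique) auto
  then show ?thesis by eventually_elim simp
qed

text \<open>
  Change of measure on a part of space where the likelihood ratio is bounded by \<open>K\<close>: there \<open>\<mu>\<close> charges
  at most \<open>K\<close> times as much as \<open>\<nu>\<close>.  This is the step that converts a small error probability
  under an alternative into a small probability of stopping early under the null.
\<close>

lemma measure_RN_deriv_le:
  assumes fin: "finite_measure \<mu>" "finite_measure \<nu>"
    and sets: "sets \<mu> = sets \<nu>" and ac: "absolutely_continuous \<nu> \<mu>"
    and E: "E \<in> sets \<nu>" and K: "0 \<le> K"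
  shows "measure \<mu> {x \<in> E. enn2real (RN_deriv \<nu> \<mu> x) \<le> K} \<le> K * measure \<nu> E"
proof -
  interpret \<mu>: finite_measure \<mu> by fact
  interpret \<nu>: finite_measure \<nu> by fact
  let ?A = "{x \<in> E. enn2real (RN_deriv \<nu> \<mu> x) \<le> K}"
  have "?A = {x \<in> space \<nu>. x \<in> E \<and> enn2real (RN_deriv \<nu> \<mu> x) \<le> K}"
    using sets.sets_into_space[OF E] by auto
  also have "\<dots> \<in> sets \<nu>" using E by measurable
  finally have A: "?A \<in> sets \<nu>" .
  \<comment> \<open>The truncation \<open>enn2real\<close> sends \<open>\<infinity>\<close> to \<open>0\<close>, so the event also contains the points of infinite
    density; they form a null set of \<open>\<nu>\<close>.\<close>
  have fn: "AE x in \<nu>. RN_deriv \<nu> \<mu> x \<noteq> \<infinity>"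
    by (rule \<nu>.RN_deriv_finite) (auto simp: ac sets \<mu>.sigma_finite_measure)
  have "emeasure \<mu> ?A = emeasure (density \<nu> (RN_deriv \<nu> \<mu>)) ?A"
    by (simp add: \<nu>.density_RN_deriv ac sets)
  also have "\<dots> = (\<integral>\<^sup>+x. RN_deriv \<nu> \<mu> x * indicator ?A x \<partial>\<nu>)"
    by (rule emeasure_density) (auto simp: A)
  also have "\<dots> \<le> (\<integral>\<^sup>+x. ennreal K * indicator E x \<partial>\<nu>)"
  proof (rule nn_integral_mono_AE, use fn in eventually_elim)
    case (elim x)
    then show ?case
      by (cases "RN_deriv \<nu> \<mu> x") (auto simp: indicator_def intro: ennreal_leI)
  qed
  also have "\<dots> = ennreal (K * measure \<nu> E)"
    using E K by (simp add: nn_integral_cmult_indicator \<nu>.emeasure_eq_measure ennreal_mult)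
  finally show ?thesis
    using K by (simp add: \<mu>.emeasure_eq_measure)
qed

section \<open>Likelihood ratios of restricted laws\<close>

lemma restrict_sources_measurable:
  "s \<subseteq> s' \<Longrightarrow> restrict_sources s \<in> path_space S s' \<rightarrow>\<^sub>M path_space S s"
  unfolding restrict_sources_def[abs_def] path_space_def
  by (rule measurable_restrict_subset) auto

lemma restrict_sources_id:
  "x \<in> space (path_space S s) \<Longrightarrow> restrict_sources s x = x"
  by (auto simp: path_space_def restrict_sources_def space_PiM PiE_def extensional_restrict)

lemma sets_obs_filtration_subset: "sets (obs_filtration S s t) \<subseteq> sets (path_space S s)"
  unfolding obs_filtration_def Let_def
proof (rule sets_image_in_sets)
  let ?J = "{m. 1 \<le> m \<and> enat m \<le> t} \<times> s"
  show "(\<lambda>x. restrict x ?J) \<in> path_space S s \<rightarrow>\<^sub>M PiM ?J (\<lambda>(m, k). S k)"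
    unfolding path_space_def by (rule measurable_restrict_subset) auto
qed simp

lemma space_obs_filtration: "space (obs_filtration S s t) = space (path_space S s)"
  by (simp add: obs_filtration_def Let_def)

lemma subalgebra_law: "subalgebra (law S s P) (obs_filtration S s t)"
  using sets_obs_filtration_subset by (auto simp: subalgebra_def law_def space_obs_filtration)

lemma sets_law_upto: "sets (law_upto S s n (law S s P)) = sets (obs_filtration S s (enat n))"
  unfolding law_upto_def by (rule sets_restr_to_subalg[OF subalgebra_law])

lemma prob_space_law_upto:
  assumes "prob_space P" "sets P = sets (path_space S s')" "s \<subseteq> s'"
  shows "prob_space (law_upto S s n (law S s P))"
proof -
  have "restrict_sources s \<in> P \<rightarrow>\<^sub>M path_space S s"
    using restrict_sources_measurable[OF assms(3)] measurable_cong_sets[OF assms(2) refl] by blast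
  then show ?thesis
    unfolding law_upto_def law_def
    by (intro prob_space_restr_to_subalg prob_space.prob_space_distr assms
        subalgebra_law[unfolded law_def])
qed

text \<open>
  For the full set of sources the passage to restricted laws is invisible: the restriction map is
  the identity on paths.
\<close>

lemma measure_law_upto_all_sources:
  assumes "sets P = sets (path_space S s)" "E \<in> sets (obs_filtration S s (enat n))"
  shows "measure (law_upto S s n (law S s P)) E = measure P E"
proof -
  have E: "E \<in> sets (path_space S s)" using assms(2) sets_obs_filtration_subset by blast
  have sp: "space P = space (path_space S s)" using assms(1) by (rule sets_eq_imp_space_eq)
  have m: "restrict_sources s \<in> P \<rightarrow>\<^sub>M path_space S s"
    using restrict_sources_measurable[of s s S] measurable_cong_sets[OF assms(1) refl] by blast
  have "restrict_sources s -` E \<inter> space P = E"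
    using sets.sets_into_space[OF E] by (auto simp: sp restrict_sources_id subset_iff)
  then have "emeasure (law S s P) E = emeasure P E"
    unfolding law_def by (simp add: emeasure_distr[OF m E])
  then show ?thesis
    unfolding law_upto_def measure_def
    by (simp add: emeasure_restr_to_subalg[OF subalgebra_law assms(2)])
qed

lemma RN_deriv_law_upto_measurable:
  "RN_deriv (law_upto S s n (law S s P)) \<nu> \<in> borel_measurable (obs_filtration S s (enat n))"
  using borel_measurable_RN_deriv measurable_cong_sets[OF sets_law_upto refl] by blast

lemma LR_measurable:
  assumes "sets R = sets (path_space S s')" "s \<subseteq> s'"
  shows "(\<lambda>x. LR S s n (law S s P) (law S s Q) x) \<in> borel_measurable R"
proof -
  have 1: "restrict_sources s \<in> R \<rightarrow>\<^sub>M path_space S s"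
    using restrict_sources_measurable[OF assms(2)] measurable_cong_sets[OF assms(1) refl] by blast
  have 2: "RN_deriv (law_upto S s n (law S s Q)) (law_upto S s n (law S s P))
      \<in> borel_measurable (path_space S s)"
    by (rule measurable_from_subalg[OF _ RN_deriv_law_upto_measurable])
      (simp add: subalgebra_def space_obs_filtration sets_obs_filtration_subset)
  show ?thesis unfolding LR_def using measurable_compose[OF 1 2] by measurable
qed

text \<open>
  The chain rule for densities, pulled back from the laws of the sources in \<open>s\<close> to the paths of all
  sources.  It makes the reference law \<open>R\<close> in the test statistics cancel.
\<close>

lemma LR_chain:
  assumes ps: "prob_space Q" "prob_space R"
    and sets: "sets P = sets (path_space S s')" "sets Q = sets (path_space S s')"
      "sets R = sets (path_space S s')"
    and s: "s \<subseteq> s'"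
    and ac: "absolutely_continuous (law_upto S s n (law S s R)) (law_upto S s n (law S s Q))"
      "absolutely_continuous (law_upto S s n (law S s Q)) (law_upto S s n (law S s P))"
  shows "AE x in P. LR S s n (law S s P) (law S s R) x =
    LR S s n (law S s P) (law S s Q) x * LR S s n (law S s Q) (law S s R) x"
proof -
  let ?U = "\<lambda>P. law_upto S s n (law S s P)"
  note [simp] = sets_law_upto
  have "prob_space (?U Q)" "prob_space (?U R)"
    using prob_space_law_upto[OF ps(1) sets(2) s] prob_space_law_upto[OF ps(2) sets(3) s] by auto
  then have fm: "sigma_finite_measure (?U Q)" "sigma_finite_measure (?U R)"
    by (auto simp: prob_space_def finite_measure_def)
  have "AE x in ?U R. RN_deriv (?U R) (?U P) x = RN_deriv (?U R) (?U Q) x * RN_deriv (?U Q) (?U P) x"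
    by (rule RN_deriv_chain) (use fm ac in auto)
  then have "AE x in ?U P. RN_deriv (?U R) (?U P) x = RN_deriv (?U R) (?U Q) x * RN_deriv (?U Q) (?U P) x"
    using ac by (intro absolutely_continuous_AE[of "?U P" "?U R"]) (auto simp: absolutely_continuous_def)
  then have "AE x in law S s P. RN_deriv (?U R) (?U P) x = RN_deriv (?U R) (?U Q) x * RN_deriv (?U Q) (?U P) x"
    unfolding law_upto_def[of S s n "law S s P"]
    by (rule AE_restr_to_subalg[OF subalgebra_law])
  moreover have "restrict_sources s \<in> P \<rightarrow>\<^sub>M path_space S s"
    using restrict_sources_measurable[OF s] measurable_cong_sets[OF sets(1) refl] by blast
  ultimately have "AE x in P. RN_deriv (?U R) (?U P) (restrict_sources s x) =
      RN_deriv (?U R) (?U Q) (restrict_sources s x) * RN_deriv (?U Q) (?U P) (restrict_sources s x)"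
    unfolding law_def[of S s P] by (rule AE_distrD[rotated])
  then show ?thesis
    by eventually_elim (simp add: LR_def enn2real_mult mult.commute)
qed

lemma LR_nonneg: "0 \<le> LR S s n \<mu> \<nu> x"
  by (simp add: LR_def)


section \<open>The families of distributions\<close>

lemma valid_settingD:
  assumes "valid_setting M"
  shows "finite (dists M)" "finite (units M)" "units M \<noteq> {}"
    and "P \<in> dists M \<Longrightarrow> prob_space P"
    and "P \<in> dists M \<Longrightarrow> sets P = sets (path_space (obs M) (sources M))"
    and "e \<in> units M \<Longrightarrow> e \<subseteq> sources M"
    and "e \<in> units M \<Longrightarrow> e \<subseteq> sdet M e \<and> sdet M e \<subseteq> sources M"
    and "e \<in> units M \<Longrightarrow> G_Psi M e \<noteq> {}"
    and "e \<in> units M \<Longrightarrow> refdet M e \<in> law (obs M) (sdet M e) ` H_null M"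
    and "e \<in> units M \<Longrightarrow> Hfam M e \<inter> Gfam M e = {}"
proof -
  have "units M \<subseteq> Pow (sources M)" "finite (Pow (sources M))"
    using assms by (auto simp: valid_setting_def sources_def)
  then show "finite (units M)" by (rule finite_subset)
qed (use assms in \<open>auto simp: valid_setting_def full_space_def\<close>)

lemma distribution_families_subset:
  "H_null M \<subseteq> dists M" "P_Psi M \<subseteq> dists M" "G_Psi M e \<subseteq> P_Psi M" "G_Psi M e \<subseteq> dists M"
  by (auto simp: H_null_def P_Psi_def G_Psi_def)

lemma anomalous_null: "valid_setting M \<Longrightarrow> P \<in> H_null M \<Longrightarrow> anomalous M P = {}"
  by (fastforce simp: H_null_def anomalous_def dest: valid_settingD(10))

text \<open>
  Under a null distribution no unit is anomalous, so the empty set is the pattern of anomalies that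
  \<open>\<Psi>\<close> has to admit.
\<close>

lemma H_null_subset_P_Psi:
  "valid_setting M \<Longrightarrow> {} \<in> Psi M \<Longrightarrow> H_null M \<subseteq> P_Psi M"
  using anomalous_null by (fastforce simp: P_Psi_def H_null_def)

lemma anomalous_nonempty: "P \<in> P_Psi M - H_null M \<Longrightarrow> anomalous M P \<noteq> {}"
  by (auto simp: P_Psi_def H_null_def anomalous_def)

lemma G_Psi_not_null:
  "valid_setting M \<Longrightarrow> Q \<in> G_Psi M e \<Longrightarrow> Q \<in> P_Psi M - H_null M"
  using anomalous_null by (fastforce simp: G_Psi_def)

lemma abs_cont_null:
  assumes "valid_setting M" "e \<in> units M" "P \<in> G_Psi M e \<union> H_null M" "Q \<in> H_null M"
    "e \<subseteq> s" "s \<subseteq> sources M" "1 \<le> n"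
  shows "absolutely_continuous (law_upto (obs M) s n (law (obs M) s P)) (law_upto (obs M) s n (law (obs M) s Q))"
    "absolutely_continuous (law_upto (obs M) s n (law (obs M) s Q)) (law_upto (obs M) s n (law (obs M) s P))"
proof -
  have "mutually_abs_cont M" using assms(1) by (simp add: valid_setting_def)
  note * = this[unfolded mutually_abs_cont_def, THEN bspec, OF assms(2), THEN bspec, OF assms(3),
      THEN bspec, of Q, THEN spec, of s, THEN mp, THEN spec, of n, THEN mp]
  show "absolutely_continuous (law_upto (obs M) s n (law (obs M) s P)) (law_upto (obs M) s n (law (obs M) s Q))"
    "absolutely_continuous (law_upto (obs M) s n (law (obs M) s Q)) (law_upto (obs M) s n (law (obs M) s P))"
    using * assms(4-7) by simp_all
qed

section \<open>Events determined by a test\<close>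

context
  fixes M :: "'x setting" and T :: "'x path \<Rightarrow> enat" and d :: "'x path \<Rightarrow> nat set set"
  assumes test: "is_test M (T, d)"
begin

interpretation filtration "space (full_space M)" "obs_filtration (obs M) (sources M)"
  unfolding full_space_def by (rule filtration_obs_filtration)

lemma test_decision_stopped:
  "{x \<in> space (full_space M). d x \<in> A \<and> T x \<le> t} \<in> sets (obs_filtration (obs M) (sources M) t)"
proof -
  have st: "stopping_time (obs_filtration (obs M) (sources M)) T"
    and d: "d \<in> pre_sigma T \<rightarrow>\<^sub>M count_space (Psi M)"
    using test by (auto simp: is_test_def)
  have "d -` (A \<inter> Psi M) \<inter> space (pre_sigma T) \<in> sets (pre_sigma T)"
    using d by (rule measurable_sets) auto
  also have "d -` (A \<inter> Psi M) \<inter> space (pre_sigma T) = {x \<in> space (full_space M). d x \<in> A}"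
    using measurable_space[OF d] by (auto simp: space_pre_sigma)
  finally show ?thesis
    using sets_pre_sigmaD[OF st] by fastforce
qed

lemma test_measurable:
  "{x \<in> space (full_space M). d x \<in> A \<and> T x \<le> t} \<in> sets (full_space M)"
  using test_decision_stopped sets_obs_filtration_subset unfolding full_space_def by blast

lemma test_decision_measurable: "{x \<in> space (full_space M). d x \<in> A} \<in> sets (full_space M)"
  using test_measurable[of A \<infinity>] by simp

lemma test_time_measurable: "{x \<in> space (full_space M). T x \<le> t} \<in> sets (full_space M)"
  using test_measurable[of UNIV t] by simp

text \<open>
  The event is the difference of the ones with \<open>T \<le> m\<close> and with \<open>T \<le> m - 1\<close>, both known at time
  \<open>m\<close>.  The change of measure needs \<open>T = m\<close> because the likelihood ratio that it uses is the one of
  the time at which the test stops.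
\<close>

lemma test_stops_at:
  assumes "1 \<le> m"
  shows "{x \<in> space (full_space M). d x \<in> A \<and> T x = enat m}
    \<in> sets (obs_filtration (obs M) (sources M) (enat m))"
proof -
  let ?E = "\<lambda>t. {x \<in> space (full_space M). d x \<in> A \<and> T x \<le> t}"
  have "sets (obs_filtration (obs M) (sources M) (enat (m - 1)))
      \<subseteq> sets (obs_filtration (obs M) (sources M) (enat m))"
    by (rule sets_F_mono) simp
  then have "?E (enat m) - ?E (enat (m - 1)) \<in> sets (obs_filtration (obs M) (sources M) (enat m))"
    using test_decision_stopped by blast
  also have "?E (enat m) - ?E (enat (m - 1)) = {x \<in> space (full_space M). d x \<in> A \<and> T x = enat m}"
  proof -
    have "k \<le> enat m \<and> \<not> k \<le> enat (m - 1) \<longleftrightarrow> k = enat m" for k :: enat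
      using assms by (cases k) auto
    then show ?thesis by blast
  qed
  finally show ?thesis .
qed

end

section \<open>No detection test stops early under the null\<close>

text \<open>
  Under \<open>P\<close> a test that stops by time \<open>n\<close> either raises a false alarm, or sees a log-likelihood ratio
  of \<open>P\<close> against \<open>Q\<close> that reaches \<open>n r\<close>, or decides for the null at a time \<open>m \<le> n\<close> at which the
  likelihood ratio is at most \<open>exp (n r)\<close>.  The events of the last kind are disjoint for different \<open>m\<close> and each
  costs at most the factor \<open>exp (n r)\<close> under the change of measure to \<open>Q\<close>; under \<open>Q\<close> their union is
  a missed detection, of probability at most \<open>b\<close>.
\<close>

lemma class_D_early_stopping_bound:
  fixes M :: "'x setting"
  assumes valid: "valid_setting M" and P: "P \<in> H_null M"
    and e: "e \<in> units M" and Q: "Q \<in> G_Psi M e"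
    and test: "(T, d) \<in> class_D M a b"
    and n: "1 \<le> n"
  defines "s \<equiv> sources M"
  shows "measure P {x \<in> space P. T x \<le> enat n} \<le> a + exp (real n * r) * b +
    measure P {x \<in> space P. real n * r \<le>
      Max ((\<lambda>m. LLR (obs M) s m (law (obs M) s P) (law (obs M) s Q) x) ` {1..n})}"
proof -
  let ?Z = "\<lambda>m x. LLR (obs M) s m (law (obs M) s P) (law (obs M) s Q) x"
  let ?L = "\<lambda>m x. LR (obs M) s m (law (obs M) s P) (law (obs M) s Q) x"
  let ?K = "exp (real n * r)"
  let ?\<Omega> = "space (full_space M)"
  have Pd: "P \<in> dists M" and Qd: "Q \<in> dists M"
    using P Q distribution_families_subset by blast+
  interpret P: prob_space P using valid_settingD(4)[OF valid Pd] .
  interpret Q: prob_space Q using valid_settingD(4)[OF valid Qd] .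
  have sP: "sets P = sets (path_space (obs M) s)" and sQ: "sets Q = sets (path_space (obs M) s)"
    using valid_settingD(5)[OF valid] Pd Qd by (auto simp: s_def)
  have sPf: "sets P = sets (full_space M)" and sQf: "sets Q = sets (full_space M)"
    using sP sQ by (auto simp: full_space_def s_def)
  have spP: "space P = ?\<Omega>" and spQ: "space Q = ?\<Omega>"
    using sPf sQf by (auto dest: sets_eq_imp_space_eq)
  have tst: "is_test M (T, d)" and lev: "measure P {x \<in> space P. d x \<noteq> {}} \<le> a"
      "measure Q {x \<in> space Q. d x = {}} \<le> b"
    using test P G_Psi_not_null[OF valid Q] by (auto simp: class_D_def)
  have T1: "x \<in> ?\<Omega> \<Longrightarrow> 1 \<le> T x" for x
    using tst by (auto simp: is_test_def)
  define E where "E m = {x \<in> ?\<Omega>. d x \<in> {{}} \<and> T x = enat m}" for m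
  have EF: "E m \<in> sets (obs_filtration (obs M) s (enat m))" if "1 \<le> m" for m
    unfolding E_def s_def by (rule test_stops_at[OF tst that])
  have EP: "E m \<in> sets P" "E m \<in> sets Q" if "1 \<le> m" for m
    using EF[OF that] sets_obs_filtration_subset unfolding sP sQ by blast+
  have Lm: "?L m \<in> borel_measurable P" for m
    by (rule LR_measurable) (auto simp: sP)
  then have Zm: "?Z m \<in> borel_measurable P" for m
    unfolding LLR_def by measurable
  have Mxm: "(\<lambda>x. Max ((\<lambda>m. ?Z m x) ` {1..n})) \<in> borel_measurable P"
    using borel_measurable_Max[of "{1..n}" "\<lambda>m. ?Z m" P] Zm n by auto
  have ELm: "{x \<in> E m. ?L m x \<le> ?K} \<in> sets P" if "1 \<le> m" for m
  proof -
    have "{x \<in> E m. ?L m x \<le> ?K} = E m \<inter> {x \<in> space P. ?L m x \<le> ?K}"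
      by (auto simp: E_def spP)
    then show ?thesis using EP[OF that] Lm[of m] by simp
  qed
  have EL: "measure P {x \<in> E m. ?L m x \<le> ?K} \<le> ?K * measure Q (E m)" if m: "1 \<le> m" for m
  proof -
    let ?U = "\<lambda>R. law_upto (obs M) s m (law (obs M) s R)"
    let ?A = "{x \<in> E m. enn2real (RN_deriv (?U Q) (?U P) x) \<le> ?K}"
    have "restrict_sources s x = x" if "x \<in> E m" for x
      using that restrict_sources_id by (auto simp: E_def full_space_def s_def)
    then have eq: "{x \<in> E m. ?L m x \<le> ?K} = ?A"
      by (auto simp: LR_def)
    have "?A = E m \<inter> {x \<in> space (obs_filtration (obs M) s (enat m)). enn2real (RN_deriv (?U Q) (?U P) x) \<le> ?K}"
      using sets.sets_into_space[OF EF[OF m]] by auto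
    also have "\<dots> \<in> sets (obs_filtration (obs M) s (enat m))"
      using RN_deriv_law_upto_measurable[of "obs M" s m Q "?U P"] EF[OF m] by measurable
    finally have A: "?A \<in> sets (obs_filtration (obs M) s (enat m))" .
    have "measure P ?A = measure (?U P) ?A"
      by (rule measure_law_upto_all_sources[symmetric, OF sP A])
    also have "\<dots> \<le> ?K * measure (?U Q) (E m)"
    proof (rule measure_RN_deriv_le)
      show "finite_measure (?U P)" "finite_measure (?U Q)"
        using prob_space_law_upto[OF P.prob_space_axioms sP] prob_space_law_upto[OF Q.prob_space_axioms sQ]
        by (auto intro: prob_space.finite_measure)
      show "absolutely_continuous (?U Q) (?U P)"
        using abs_cont_null(1)[OF valid e _ P] Q valid_settingD(6)[OF valid e] m
        unfolding s_def by auto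
    qed (use EF[OF m] in \<open>auto simp: sets_law_upto\<close>)
    also have "measure (?U Q) (E m) = measure Q (E m)"
      by (rule measure_law_upto_all_sources[OF sQ EF[OF m]])
    finally show ?thesis unfolding eq .
  qed
  have disj: "disjoint_family_on E {1..n}"
    by (auto simp: disjoint_family_on_def E_def)
  let ?B1 = "{x \<in> space P. d x \<noteq> {}}"
  let ?B2 = "\<Union>m\<in>{1..n}. {x \<in> E m. ?L m x \<le> ?K}"
  let ?B3 = "{x \<in> space P. real n * r \<le> Max ((\<lambda>m. ?Z m x) ` {1..n})}"
  have B1: "?B1 \<in> sets P"
    using test_decision_measurable[OF tst, of "- {{}}"] by (simp add: spP sPf)
  have B2: "?B2 \<in> sets P" using ELm by auto
  have B3: "?B3 \<in> sets P" using Mxm by measurable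
  have "{x \<in> space P. T x \<le> enat n} \<subseteq> ?B1 \<union> ?B2 \<union> ?B3"
  proof (intro subsetI, rule ccontr)
    fix x assume x: "x \<in> {x \<in> space P. T x \<le> enat n}" and nx: "x \<notin> ?B1 \<union> ?B2 \<union> ?B3"
    obtain m where m: "T x = enat m" "m \<le> n" using x by (cases "T x") auto
    have m1: "1 \<le> m" using T1[of x] x m by (simp add: spP one_enat_def)
    have "?Z m x < real n * r"
    proof -
      have "?Z m x \<le> Max ((\<lambda>m. ?Z m x) ` {1..n})"
        using m m1 by (intro Max_ge) auto
      then show ?thesis using nx x by auto
    qed
    then have "?L m x \<le> ?K"
      using LR_nonneg[of "obs M" s m "law (obs M) s P" "law (obs M) s Q" x]
      by (cases "?L m x = 0") (auto simp: LLR_def ln_ge_iff not_le[symmetric])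
    moreover have "x \<in> E m" using nx x m by (auto simp: E_def spP)
    ultimately show False using nx m m1 by auto
  qed
  then have "measure P {x \<in> space P. T x \<le> enat n} \<le> measure P (?B1 \<union> ?B2 \<union> ?B3)"
    using B1 B2 B3 by (intro P.finite_measure_mono) auto
  also have "\<dots> \<le> measure P ?B1 + measure P ?B2 + measure P ?B3"
    using measure_Un_le[of "?B1 \<union> ?B2" P ?B3] measure_Un_le[of ?B1 P ?B2] B1 B2 B3 by auto
  also have "measure P ?B2 \<le> (\<Sum>m\<in>{1..n}. measure P {x \<in> E m. ?L m x \<le> ?K})"
    using ELm by (intro measure_UNION_le) auto
  also have "\<dots> \<le> (\<Sum>m\<in>{1..n}. ?K * measure Q (E m))"
    using EL by (intro sum_mono) auto
  also have "\<dots> = ?K * measure Q (\<Union>m\<in>{1..n}. E m)"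
    using EP disj by (subst Q.finite_measure_finite_Union) (auto simp: sum_distrib_left)
  also have "measure Q (\<Union>m\<in>{1..n}. E m) \<le> measure Q {x \<in> space Q. d x = {}}"
    using test_decision_measurable[OF tst, of "{{}}"]
    by (intro Q.finite_measure_mono) (auto simp: E_def spQ sQf)
  finally show ?thesis using lev
    by (smt (verit, best) exp_gt_zero mult_left_mono)
qed

text \<open>
  Markov's inequality; the factor is \<open>n + 1\<close> because an integer time above \<open>n\<close> is at least \<open>n + 1\<close>, which
  makes up for rounding the horizon down.
\<close>

lemma expected_time_ge_tail:
  assumes P: "prob_space P" and meas: "{x \<in> space P. T x \<le> enat n} \<in> sets P"
    and c: "measure P {x \<in> space P. T x \<le> enat n} \<le> c"
  shows "ennreal (real (Suc n) * (1 - c)) \<le> expected_time P T"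
proof -
  interpret prob_space P by fact
  let ?A = "space P - {x \<in> space P. T x \<le> enat n}"
  have A: "?A \<in> sets P" using meas by auto
  have "1 - c \<le> measure P ?A"
    using prob_compl[OF meas] c by simp
  then have "ennreal (real (Suc n) * (1 - c)) \<le> ennreal (real (Suc n) * measure P ?A)"
    by (intro ennreal_leI mult_left_mono) auto
  also have "\<dots> = (\<integral>\<^sup>+x. ennreal (real (Suc n)) * indicator ?A x \<partial>P)"
    using A by (simp add: nn_integral_cmult_indicator emeasure_eq_measure ennreal_mult)
  also have "\<dots> \<le> expected_time P T"
    unfolding expected_time_def
  proof (rule nn_integral_mono)
    fix x assume "x \<in> space P"
    show "ennreal (real (Suc n)) * indicator ?A x \<le> ennreal_of_enat (T x)"
    proof (cases "x \<in> ?A")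
      case True
      then have "enat (Suc n) \<le> T x" by (cases "T x") auto
      then have "ennreal_of_enat (enat (Suc n)) \<le> ennreal_of_enat (T x)"
        by (simp only: ennreal_of_enat_le_iff)
      then show ?thesis using True by (simp add: ennreal_of_nat_eq_real_of_nat del: of_nat_Suc)
    qed auto
  qed
  finally show ?thesis .
qed

section \<open>The null stopping time\<close>

text \<open>
  The maximum over \<open>H_null M\<close> in the denominator of the detection statistic includes the ratio of
  the true distribution \<open>P\<close>.  By the chain rule the numerator is at most \<open>1 / c\<close> times that ratio once
  \<open>P\<close> dominates every alternative by the factor \<open>c\<close>.
\<close>

lemma Lambda_det_le_inverse:
  fixes M :: "'x setting"
  assumes valid: "valid_setting M" and P: "P \<in> H_null M" and e: "e \<in> units M" and n: "1 \<le> n"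
  defines "S \<equiv> obs M" and "s \<equiv> sdet M e"
  shows "AE x in P. \<forall>c>0. (\<forall>Q\<in>G_Psi M e. c \<le> LR S s n (law S s P) (law S s Q) x)
    \<longrightarrow> Lambda_det M e n x \<le> 1 / c"
proof -
  obtain R where R: "R \<in> H_null M" and ref: "refdet M e = law S s R"
    using valid_settingD(9)[OF valid e] by (auto simp: S_def s_def)
  have s: "e \<subseteq> s" "s \<subseteq> sources M"
    using valid_settingD(7)[OF valid e] by (auto simp: s_def)
  have fin: "finite (G_Psi M e)" "finite (H_null M)"
    using valid_settingD(1)[OF valid] distribution_families_subset by (metis finite_subset)+
  have ne: "G_Psi M e \<noteq> {}" using valid_settingD(8)[OF valid e] .
  have d: "P \<in> dists M" "R \<in> dists M" "\<And>Q. Q \<in> G_Psi M e \<Longrightarrow> Q \<in> dists M"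
    using P R distribution_families_subset by blast+
  have "AE x in P. LR S s n (law S s P) (law S s R) x =
      LR S s n (law S s P) (law S s Q) x * LR S s n (law S s Q) (law S s R) x"
    if Q: "Q \<in> G_Psi M e" for Q
    unfolding S_def
  proof (rule LR_chain[where s' = "sources M"])
    show "absolutely_continuous (law_upto (obs M) s n (law (obs M) s R)) (law_upto (obs M) s n (law (obs M) s Q))"
      using abs_cont_null(2)[OF valid e _ R s n, of Q] Q by simp
    show "absolutely_continuous (law_upto (obs M) s n (law (obs M) s Q)) (law_upto (obs M) s n (law (obs M) s P))"
      using abs_cont_null(1)[OF valid e _ P s n, of Q] Q by simp
  qed (use d Q s valid_settingD(4,5)[OF valid] in auto)
  then have "AE x in P. \<forall>Q\<in>G_Psi M e. LR S s n (law S s P) (law S s R) x =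
      LR S s n (law S s P) (law S s Q) x * LR S s n (law S s Q) (law S s R) x"
    using fin by (intro AE_finite_allI) auto
  then show ?thesis
  proof eventually_elim
    case (elim x)
    show ?case
    proof (intro allI impI)
      fix c :: real assume c: "0 < c" and le: "\<forall>Q\<in>G_Psi M e. c \<le> LR S s n (law S s P) (law S s Q) x"
      let ?g = "Max ((\<lambda>\<mu>. LR S s n \<mu> (law S s R) x) ` law S s ` G_Psi M e)"
      let ?h = "Max ((\<lambda>\<mu>. LR S s n \<mu> (law S s R) x) ` law S s ` H_null M)"
      have Ph: "LR S s n (law S s P) (law S s R) x \<le> ?h"
        using fin P by (intro Max_ge) auto
      have "?g \<in> (\<lambda>\<mu>. LR S s n \<mu> (law S s R) x) ` law S s ` G_Psi M e"
        using fin ne by (intro Max_in) auto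
      then obtain Q where Q: "Q \<in> G_Psi M e" "?g = LR S s n (law S s Q) (law S s R) x" by auto
      have "c * ?g \<le> LR S s n (law S s P) (law S s Q) x * LR S s n (law S s Q) (law S s R) x"
        unfolding Q(2) using le Q(1) LR_nonneg by (intro mult_right_mono) auto
      also have "\<dots> = LR S s n (law S s P) (law S s R) x" using elim Q(1) by simp
      finally have gh: "c * ?g \<le> ?h" using Ph by simp
      have h0: "0 \<le> ?h" using Ph LR_nonneg order_trans by blast
      have "?g / ?h \<le> 1 / c"
      \<comment> \<open>If the denominator vanishes then the quotient is \<open>0\<close> by the convention for division.\<close>
      proof (cases "?h = 0")
        case False
        then show ?thesis using gh h0 c by (simp add: field_simps)
      qed (use c in simp)
      then show "Lambda_det M e n x \<le> 1 / c"
        unfolding Lambda_det_def ref S_def s_def by (simp add: image_image)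
    qed
  qed
qed

text \<open>
  Call the time \<open>n + 1\<close> bad if \<open>B n \<ge> 1\<close>.  If \<open>T\<close> does not exceed the first time after \<open>N\<close> that is not
  bad, then all the times from \<open>N + 1\<close> to \<open>T - 1\<close> are bad, so that the sum of \<open>B\<close> accounts for the excess of
  \<open>T\<close> over \<open>N + 1\<close>.  Taking expectations then only requires the probability of each bad event.
\<close>

lemma first_passage_le_count:
  fixes T :: enat and B :: "nat \<Rightarrow> ennreal"
  assumes stop: "\<And>n. N \<le> n \<Longrightarrow> B n < 1 \<Longrightarrow> T \<le> enat (Suc n)"
  shows "ennreal_of_enat T \<le> of_nat (Suc N) + (\<Sum>n. B n)"
proof -
  have count: "of_nat m \<le> (\<Sum>n. B n)" if "\<And>k. k < m \<Longrightarrow> 1 \<le> B (N + k)" for m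
  proof -
    have "(of_nat m :: ennreal) = (\<Sum>k<m. 1)" by simp
    also have "\<dots> \<le> (\<Sum>k<m. B (N + k))" using that by (intro sum_mono) auto
    also have "\<dots> = sum B ((\<lambda>k. N + k) ` {..<m})" by (subst sum.reindex) auto
    also have "\<dots> \<le> (\<Sum>n. B n)" by (intro sum_le_suminf) auto
    finally show ?thesis .
  qed
  show ?thesis
  proof (cases "\<exists>k. B (N + k) < 1")
    case True
    define m where "m = (LEAST k. B (N + k) < 1)"
    have m: "B (N + m) < 1" unfolding m_def using True by (rule LeastI_ex)
    have "1 \<le> B (N + k)" if "k < m" for k
      using not_less_Least[of k "\<lambda>k. B (N + k) < 1"] that by (auto simp: m_def not_less)
    then have "of_nat m \<le> (\<Sum>n. B n)" by (rule count)
    moreover have "ennreal_of_enat T \<le> ennreal_of_enat (enat (Suc (N + m)))"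
      using stop[OF _ m] by (simp only: ennreal_of_enat_le_iff le_add1)
    moreover have "ennreal_of_enat (enat (Suc (N + m))) = of_nat (Suc N) + of_nat m"
      by simp
    ultimately show ?thesis by (metis add_left_mono order_trans)
  next
    case False
    then have "of_nat m \<le> (\<Sum>n. B n)" for m by (intro count) (auto simp: not_less)
    then have "(\<Sum>n. B n) = \<top>"
      by (metis ennreal_Ex_less_of_nat less_top not_less)
    then show ?thesis by simp
  qed
qed

text \<open>
  The time \<open>n + 1\<close> is bad if some log-likelihood ratio of \<open>P\<close> against an alternative is below
  \<open>(n + 1) r\<close>.  A time after \<open>N\<close> that is not bad stops the null rule, and complete convergence
  bounds the expected number of bad times by a finite constant \<open>S\<close>, which does not depend on the
  thresholds.
\<close>

lemma null_time_bound:
  fixes M :: "'x setting"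
  assumes valid: "valid_setting M" and CC: "condition_CC M I" and P: "P \<in> H_null M"
    and r0: "0 < r" and r: "r < Min ((\<lambda>e. min_info M I P (G_Psi M e) (sdet M e)) ` units M)"
  obtains S where "\<And>C N. (\<And>e. e \<in> units M \<Longrightarrow> 0 < C e \<and> ln (C e) \<le> real N * r) \<Longrightarrow>
    expected_time P (T_null M C) \<le> ennreal (real (Suc N) + S)" "0 \<le> S"
proof -
  define S where "S = obs M"
  define Z where "Z e Q n x = LLR S (sdet M e) n (law S (sdet M e) P) (law S (sdet M e) Q) x" for e Q n x
  define bad where "bad e Q n = {x \<in> space P. Z e Q (Suc n) x < real (Suc n) * r}" for e Q n
  define B where "B n x = (\<Sum>e\<in>units M. \<Sum>Q\<in>G_Psi M e. indicator (bad e Q n) x :: ennreal)" for n x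
  have Pd: "P \<in> dists M" using P distribution_families_subset by blast
  interpret prob_space P using valid_settingD(4)[OF valid Pd] .
  note finU = valid_settingD(2)[OF valid]
  have finG: "finite (G_Psi M e)" for e
    using valid_settingD(1)[OF valid] distribution_families_subset by (metis finite_subset)
  have Zm: "Z e Q n \<in> borel_measurable P" if "e \<in> units M" for e Q n
    unfolding Z_def LLR_def S_def using valid_settingD(5)[OF valid Pd] valid_settingD(7)[OF valid that]
    by (intro borel_measurable_ln LR_measurable) auto
  have badm: "bad e Q n \<in> sets P" if "e \<in> units M" for e Q n
    unfolding bad_def using Zm[OF that] by measurable
  have Bm: "B n \<in> borel_measurable P" for n
    unfolding B_def[abs_def] using badm by measurable
  have smb: "summable (\<lambda>n. measure P (bad e Q n))" if e: "e \<in> units M" and Q: "Q \<in> G_Psi M e" for e Q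
  proof -
    have s: "e \<subseteq> sdet M e \<and> sdet M e \<subseteq> sources M" using valid_settingD(7)[OF valid e] .
    have "Min ((\<lambda>e. min_info M I P (G_Psi M e) (sdet M e)) ` units M)
        \<le> min_info M I P (G_Psi M e) (sdet M e)"
      using finU e by (intro Min_le) auto
    also have "\<dots> \<le> I (law S (sdet M e) P) (law S (sdet M e) Q)"
      unfolding min_info_def S_def using finG Q by (intro Min_le) auto
    finally have "r < I (law S (sdet M e) P) (law S (sdet M e) Q)" using r by simp
    then show ?thesis
      using CC[unfolded condition_CC_def Let_def, THEN bspec, OF e, THEN bspec, OF Q, THEN bspec, of P,
          THEN spec, of "sdet M e"] P s
      by (simp add: bad_def Z_def S_def)
  qed
  define tot where "tot n = (\<Sum>e\<in>units M. \<Sum>Q\<in>G_Psi M e. measure P (bad e Q n))" for n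
  have tot0: "0 \<le> tot n" for n unfolding tot_def by (intro sum_nonneg) auto
  have stot: "summable tot" unfolding tot_def[abs_def] using smb by (intro summable_sum)
  have BI: "(\<integral>\<^sup>+x. (\<Sum>n. B n x) \<partial>P) = ennreal (suminf tot)"
  proof -
    have "(\<integral>\<^sup>+x. B n x \<partial>P) = ennreal (tot n)" for n
      unfolding B_def tot_def using badm
      by (subst nn_integral_sum, measurable)
        (auto simp: nn_integral_sum emeasure_eq_measure sum_ennreal sum_nonneg intro!: sum.cong)
    then have "(\<integral>\<^sup>+x. (\<Sum>n. B n x) \<partial>P) = (\<Sum>n. ennreal (tot n))"
      using Bm by (subst nn_integral_suminf) auto
    also have "\<dots> = ennreal (suminf tot)" using tot0 stot by (rule suminf_ennreal2)
    finally show ?thesis .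
  qed
  have AEs: "AE x in P. \<forall>n. \<forall>e\<in>units M. \<forall>c>0. (\<forall>Q\<in>G_Psi M e.
      c \<le> LR S (sdet M e) (Suc n) (law S (sdet M e) P) (law S (sdet M e) Q) x)
      \<longrightarrow> Lambda_det M e (Suc n) x \<le> 1 / c"
    unfolding S_def using finU Lambda_det_le_inverse[OF valid P]
    by (subst AE_all_countable, intro allI AE_finite_allI) auto
  have main: "expected_time P (T_null M C) \<le> ennreal (real (Suc N) + suminf tot)"
    if C: "\<And>e. e \<in> units M \<Longrightarrow> 0 < C e \<and> ln (C e) \<le> real N * r" for C N
  proof -
    have "AE x in P. ennreal_of_enat (T_null M C x) \<le> of_nat (Suc N) + (\<Sum>n. B n x)"
      using AEs AE_space
    proof eventually_elim
      case (elim x)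
      show ?case
      proof (rule first_passage_le_count)
        fix n assume n: "N \<le> n" and B: "B n x < 1"
        have good: "real (Suc n) * r \<le> Z e Q (Suc n) x" if e: "e \<in> units M" and Q: "Q \<in> G_Psi M e" for e Q
        proof (rule ccontr)
          assume "\<not> ?thesis"
          then have "(1::ennreal) = indicator (bad e Q n) x" using elim(2) by (auto simp: bad_def)
          also have "\<dots> \<le> (\<Sum>Q\<in>G_Psi M e. indicator (bad e Q n) x)"
            using Q finG by (intro member_le_sum) auto
          also have "\<dots> \<le> B n x"
            unfolding B_def using e finU by (intro member_le_sum) auto
          finally show False using B by simp
        qed
        have "Lambda_det M e (Suc n) x \<le> 1 / C e" if e: "e \<in> units M" for e
        proof -
          have "C e \<le> LR S (sdet M e) (Suc n) (law S (sdet M e) P) (law S (sdet M e) Q) x"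
            if Q: "Q \<in> G_Psi M e" for Q
          proof -
            let ?l = "LR S (sdet M e) (Suc n) (law S (sdet M e) P) (law S (sdet M e) Q) x"
            have pos: "0 < real (Suc n) * r" using r0 by simp
            have ln: "real (Suc n) * r \<le> ln ?l" using good[OF e Q] by (simp add: Z_def LLR_def)
            \<comment> \<open>\<open>ln 0 = 0\<close>, so a positive logarithm excludes a vanishing ratio.\<close>
            have l: "0 < ?l"
              using pos ln LR_nonneg[of S "sdet M e" "Suc n" "law S (sdet M e) P" "law S (sdet M e) Q" x]
              by (cases "?l = 0") auto
            have "real N * r \<le> real (Suc n) * r"
              using n r0 by (intro mult_right_mono) auto
            then have "ln (C e) \<le> ln ?l" using C[OF e] ln by linarith
            then show ?thesis using C[OF e] l by simp
          qed
          then show ?thesis using elim(1) e C[OF e] by blast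
        qed
        then show "T_null M C x \<le> enat (Suc n)"
          unfolding T_null_def by (intro Inf_lower) auto
      qed
    qed
    then have "expected_time P (T_null M C) \<le> (\<integral>\<^sup>+x. of_nat (Suc N) + (\<Sum>n. B n x) \<partial>P)"
      unfolding expected_time_def by (rule nn_integral_mono_AE)
    also have "\<dots> = of_nat (Suc N) + ennreal (suminf tot)"
      using Bm by (subst nn_integral_add) (auto simp: BI emeasure_space_1)
    also have "\<dots> = ennreal (real (Suc N) + suminf tot)"
      using suminf_nonneg[OF stot tot0] by (simp add: ennreal_of_nat_eq_real_of_nat ennreal_plus del: of_nat_Suc)
    finally show ?thesis .
  qed
  show ?thesis using that[OF main] suminf_nonneg[OF stot tot0] by blast
qed

section \<open>Asymptotic comparison\<close>

lemma min_info_pos: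
  assumes valid: "valid_setting M" and I: "info_positive M I" and P: "P \<in> H_null M" and e: "e \<in> units M"
  shows "0 < min_info M I P (G_Psi M e) (sources M)"
proof -
  have fin: "finite (G_Psi M e)"
    using valid_settingD(1)[OF valid] distribution_families_subset by (metis finite_subset)
  have "0 < I (law (obs M) (sources M) P) (law (obs M) (sources M) Q)" if "Q \<in> G_Psi M e" for Q
    using I[unfolded info_positive_def, THEN bspec, OF e, THEN bspec, OF that, THEN bspec, of P,
        THEN spec, of "sources M"] P valid_settingD(6)[OF valid e] by simp
  then show ?thesis
    unfolding min_info_def using fin valid_settingD(8)[OF valid e] by (subst Min_gr_iff) auto
qed

lemma asymp_equiv_if_eventually_close:
  fixes f L :: "'b \<Rightarrow> real"
  assumes L: "eventually (\<lambda>x. 0 < L x) F"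
    and lo: "\<And>\<epsilon>. 0 < \<epsilon> \<Longrightarrow> \<epsilon> < 1 \<Longrightarrow> eventually (\<lambda>x. (1 - \<epsilon>) * L x \<le> f x) F"
    and up: "\<And>\<epsilon>. 0 < \<epsilon> \<Longrightarrow> \<epsilon> < 1 \<Longrightarrow> eventually (\<lambda>x. f x \<le> (1 + \<epsilon>) * L x) F"
  shows "f \<sim>[F] L"
proof (rule asymp_equivI', rule tendstoI)
  fix \<eta> :: real assume \<eta>: "0 < \<eta>"
  define \<epsilon> where "\<epsilon> = min \<eta> 1 / 2"
  have \<epsilon>: "0 < \<epsilon>" "\<epsilon> < 1" "\<epsilon> < \<eta>" using \<eta> by (auto simp: \<epsilon>_def min_def)
  from L lo[OF \<epsilon>(1,2)] up[OF \<epsilon>(1,2)] show "eventually (\<lambda>x. dist (f x / L x) 1 < \<eta>) F"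
  proof eventually_elim
    case (elim x)
    then have "1 - \<epsilon> \<le> f x / L x" "f x / L x \<le> 1 + \<epsilon>" by (simp_all add: field_simps)
    then show ?case using \<epsilon> by (simp add: dist_real_def abs_le_iff)
  qed
qed

lemma filterlim_abs_ln_at_top:
  fixes b :: "'b \<Rightarrow> real"
  assumes "filterlim b (at_right 0) F"
  shows "filterlim (\<lambda>x. \<bar>ln (b x)\<bar>) at_top F"
  using filterlim_compose[OF filterlim_abs_real
      filterlim_compose[OF filterlim_uminus_at_top_at_bot filterlim_compose[OF ln_at_0 assms]]] by simp

lemma eventually_at_right_0_unit:
  assumes "filterlim b (at_right (0::real)) F"
  shows "eventually (\<lambda>x. b x \<in> {0<..<1}) F"
  using assms eventually_at_right_real[of 0 1] by (auto simp: filterlim_iff)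

lemma filterlim_nat_floor:
  assumes "filterlim f at_top F"
  shows "filterlim (\<lambda>x. nat \<lfloor>f x :: real\<rfloor>) sequentially F"
  by (rule filterlim_compose[OF filterlim_nat_sequentially
        filterlim_compose[OF filterlim_floor_sequentially assms]])

text \<open>
  \<open>J\<close> is attained by a pair of a unit and an alternative \<open>Q\<close>.  The bound on early stopping is used
  with this \<open>Q\<close>, with a rate \<open>r\<close> slightly above \<open>J\<close> and a horizon slightly below \<open>\<bar>ln b\<bar> / J\<close>: the rate
  makes the log-likelihood ratio exceed \<open>n r\<close> with vanishing probability by condition (M), and the
  horizon keeps \<open>exp (n r) * b\<close> small.  The estimate is uniform over the class of tests, as the bound
  does not depend on the test.
\<close>

lemma class_D_expected_time_lower:
  fixes M :: "'x setting" and a b :: "'b \<Rightarrow> real"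
  assumes valid: "valid_setting M" and I: "info_positive M I" and CM: "condition_M M I"
    and P: "P \<in> H_null M"
    and a: "filterlim a (at_right 0) F" and b: "filterlim b (at_right 0) F"
    and \<epsilon>: "0 < \<epsilon>" "\<epsilon> < 1"
  defines "J \<equiv> Min ((\<lambda>e. min_info M I P (G_Psi M e) (sources M)) ` units M)"
  shows "eventually (\<lambda>x. \<forall>(T, d)\<in>class_D M (a x) (b x).
    ennreal ((1 - \<epsilon>) * (\<bar>ln (b x)\<bar> / J)) \<le> expected_time P T) F"
proof -
  let ?law = "\<lambda>Q. law (obs M) (sources M) Q"
  have finG: "finite (G_Psi M e)" for e
    using valid_settingD(1)[OF valid] distribution_families_subset by (metis finite_subset)
  have "J \<in> (\<lambda>e. min_info M I P (G_Psi M e) (sources M)) ` units M"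
    unfolding J_def using valid_settingD(2,3)[OF valid] by (intro Min_in) auto
  then obtain e where e: "e \<in> units M" and Je: "J = min_info M I P (G_Psi M e) (sources M)" by auto
  have "J \<in> (\<lambda>Q. I (?law P) (?law Q)) ` G_Psi M e"
    unfolding Je min_info_def using finG valid_settingD(8)[OF valid e] by (intro Min_in) auto
  then obtain Q where Q: "Q \<in> G_Psi M e" and JQ: "J = I (?law P) (?law Q)" by auto
  have J: "0 < J" using min_info_pos[OF valid I P e] Je by simp
  \<comment> \<open>Three factors \<open>1 - \<eta>\<close> are lost: two in the horizon and one in the tail probability.\<close>
  define \<eta> where "\<eta> = \<epsilon> / 4"
  have \<eta>: "0 < \<eta>" "\<eta> < 1" using \<epsilon> by (auto simp: \<eta>_def)
  define r where "r = J / (1 - \<eta>)"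
  have r: "J < r" "0 < r" using J \<eta> by (auto simp: r_def field_simps)
  define q where "q n = measure P {x \<in> space P. real n * r \<le>
      Max ((\<lambda>m. LLR (obs M) (sources M) m (?law P) (?law Q) x) ` {1..n})}" for n
  have q: "q \<longlonglongrightarrow> 0"
    using CM[unfolded condition_M_def Let_def, THEN bspec, OF e, THEN bspec, OF Q, THEN bspec, of P,
          THEN spec, of "sources M"] P valid_settingD(6)[OF valid e] r
    by (simp add: q_def[abs_def] JQ)
  \<comment> \<open>Since \<open>n r \<le> (1 - \<eta>) \<bar>ln b\<bar>\<close>, the factor \<open>exp (n r) * b\<close> is at most \<open>exp (- \<eta> \<bar>ln b\<bar>)\<close>.\<close>
  define n where "n x = nat \<lfloor>(1 - \<eta>)\<^sup>2 / J * \<bar>ln (b x)\<bar>\<rfloor>" for x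
  have "filterlim (\<lambda>x. (1 - \<eta>)\<^sup>2 / J * \<bar>ln (b x)\<bar>) at_top F"
    using J \<eta> by (intro filterlim_tendsto_pos_mult_at_top[OF tendsto_const] filterlim_abs_ln_at_top[OF b]) auto
  then have nlim: "filterlim n sequentially F" unfolding n_def[abs_def] by (rule filterlim_nat_floor)
  define c where "c x = a x + exp (- \<eta> * \<bar>ln (b x)\<bar>) + q (n x)" for x
  have "filterlim (\<lambda>x. \<eta> * \<bar>ln (b x)\<bar>) at_top F"
    using \<eta> by (intro filterlim_tendsto_pos_mult_at_top[OF tendsto_const] filterlim_abs_ln_at_top[OF b]) auto
  then have "filterlim (\<lambda>x. - \<eta> * \<bar>ln (b x)\<bar>) at_bot F"
    by (simp add: filterlim_uminus_at_top)
  then have "((\<lambda>x. exp (- \<eta> * \<bar>ln (b x)\<bar>)) \<longlongrightarrow> 0) F"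
    by (rule filterlim_compose[OF exp_at_bot])
  moreover have "((\<lambda>x. q (n x)) \<longlongrightarrow> 0) F" by (rule filterlim_compose[OF q nlim])
  moreover have "(a \<longlongrightarrow> 0) F" using a by (simp add: filterlim_at)
  ultimately have "(c \<longlongrightarrow> 0) F"
    unfolding c_def[abs_def] by (intro tendsto_add_zero)
  then have "eventually (\<lambda>x. c x < \<eta>) F" using \<eta>(1) by (rule order_tendstoD)
  moreover have "eventually (\<lambda>x. 1 \<le> n x) F"
    using nlim by (auto simp: filterlim_at_top)
  moreover note eventually_at_right_0_unit[OF b]
  ultimately show ?thesis
  proof eventually_elim
    case (elim x)
    show ?case
    proof (clarify)
      fix T d assume test: "(T, d) \<in> class_D M (a x) (b x)"
      define l where "l = \<bar>ln (b x)\<bar>"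
      have l: "0 \<le> l" "b x = exp (- l)" using elim(3) by (auto simp: l_def)
      have Pd: "P \<in> dists M" using P distribution_families_subset by blast
      have "real (n x) \<le> (1 - \<eta>)\<^sup>2 / J * l"
        unfolding n_def l_def[symmetric] using J l(1) by (intro of_nat_floor) auto
      then have "real (n x) * r \<le> (1 - \<eta>)\<^sup>2 / J * l * r"
        using r by (intro mult_right_mono) auto
      also have "\<dots> = (1 - \<eta>) * l"
        using J \<eta> by (simp add: r_def power2_eq_square)
      finally have "exp (real (n x) * r) * b x \<le> exp (- \<eta> * l)"
        unfolding l(2) exp_add[symmetric] by (simp add: algebra_simps)
      then have "measure P {y \<in> space P. T y \<le> enat (n x)} \<le> c x"
        using class_D_early_stopping_bound[OF valid P e Q test elim(2), of r]
        unfolding c_def q_def l_def[symmetric] by linarith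
      then have tail: "measure P {y \<in> space P. T y \<le> enat (n x)} \<le> \<eta>" using elim(1) by simp
      have "sets P = sets (full_space M)"
        using valid_settingD(5)[OF valid Pd] by (simp add: full_space_def)
      then have "{y \<in> space P. T y \<le> enat (n x)} \<in> sets P"
        using test_time_measurable[of M T d "enat (n x)"] test sets_eq_imp_space_eq[of P "full_space M"]
        by (simp add: class_D_def)
      then have E: "ennreal (real (Suc (n x)) * (1 - \<eta>)) \<le> expected_time P T"
        using tail valid_settingD(4)[OF valid Pd] by (intro expected_time_ge_tail)
      have "1 - \<epsilon> \<le> (1 - \<eta>) ^ 3"
        using Bernoulli_inequality[of "- \<eta>" 3] \<eta> \<epsilon> by (simp add: \<eta>_def)
      then have "(1 - \<epsilon>) * (l / J) \<le> (1 - \<eta>) ^ 3 * (l / J)"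
        using l J by (intro mult_right_mono) auto
      also have "\<dots> = ((1 - \<eta>)\<^sup>2 / J * l) * (1 - \<eta>)"
        by (simp add: power2_eq_square power3_eq_cube)
      also have "\<dots> \<le> real (Suc (n x)) * (1 - \<eta>)"
      proof (rule mult_right_mono)
        show "(1 - \<eta>)\<^sup>2 / J * l \<le> real (Suc (n x))"
          unfolding n_def l_def[symmetric] by linarith
      qed (use \<eta> in simp)
      finally show "ennreal ((1 - \<epsilon>) * (\<bar>ln (b x)\<bar> / J)) \<le> expected_time P T"
        using E order_trans ennreal_leI unfolding l_def by blast
    qed
  qed
qed

text \<open>
  With a rate \<open>r\<close> slightly below \<open>J\<close>, the number \<open>N\<close> of observations after which \<open>N r\<close> exceeds all the
  \<open>ln (C e)\<close> is about \<open>\<bar>ln b\<bar> / J\<close>, and the further delay is a constant.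
\<close>

lemma null_time_expected_upper:
  fixes M :: "'x setting" and b :: "'b \<Rightarrow> real" and C :: "'b \<Rightarrow> thresholds"
  assumes valid: "valid_setting M" and CC: "condition_CC M I" and P: "P \<in> H_null M"
    and b: "filterlim b (at_right 0) F"
    and Cpos: "eventually (\<lambda>x. \<forall>e\<in>units M. 0 < C x e) F"
    and Casym: "\<And>e. e \<in> units M \<Longrightarrow> (\<lambda>x. ln (C x e)) \<sim>[F] (\<lambda>x. \<bar>ln (b x)\<bar>)"
    and \<epsilon>: "0 < \<epsilon>" "\<epsilon> < 1"
  defines "J \<equiv> Min ((\<lambda>e. min_info M I P (G_Psi M e) (sdet M e)) ` units M)"
  assumes J: "0 < J"
  shows "eventually (\<lambda>x. expected_time P (T_null M (C x)) \<le> ennreal ((1 + \<epsilon>) * (\<bar>ln (b x)\<bar> / J))) F"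
proof -
  \<comment> \<open>One factor \<open>1 + \<eta>\<close> comes from the rate and one from the thresholds; a further multiple \<open>\<eta>\<close> of
    \<open>\<bar>ln b\<bar> / J\<close> absorbs the constant delay.\<close>
  define \<eta> where "\<eta> = \<epsilon> / 8"
  have \<eta>: "0 < \<eta>" "\<eta> < 1" using \<epsilon> by (auto simp: \<eta>_def)
  define r where "r = J / (1 + \<eta>)"
  have r: "0 < r" "r < J" using J \<eta> by (auto simp: r_def field_simps)
  obtain S where S: "\<And>C N. (\<And>e. e \<in> units M \<Longrightarrow> 0 < C e \<and> ln (C e) \<le> real N * r) \<Longrightarrow>
      expected_time P (T_null M C) \<le> ennreal (real (Suc N) + S)" "0 \<le> S"
    using null_time_bound[OF valid CC P r(1) r(2)[unfolded J_def]] by metis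
  note lim = filterlim_abs_ln_at_top[OF b]
  have "eventually (\<lambda>x. \<forall>e\<in>units M. ln (C x e) \<le> (1 + \<eta>) * \<bar>ln (b x)\<bar>) F"
  proof (rule eventually_ball_finite[OF valid_settingD(2)[OF valid]], rule ballI)
    fix e assume e: "e \<in> units M"
    have pos: "eventually (\<lambda>x. 0 < \<bar>ln (b x)\<bar>) F"
      using lim unfolding filterlim_at_top_dense by blast
    then have "((\<lambda>x. ln (C x e) / \<bar>ln (b x)\<bar>) \<longlongrightarrow> 1) F"
      using Casym[OF e] by (intro asymp_equivD_strong) (auto elim: eventually_mono)
    then have "eventually (\<lambda>x. ln (C x e) / \<bar>ln (b x)\<bar> < 1 + \<eta>) F"
      using \<eta> by (intro order_tendstoD(2)) auto
    with pos show "eventually (\<lambda>x. ln (C x e) \<le> (1 + \<eta>) * \<bar>ln (b x)\<bar>) F"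
      by eventually_elim (simp add: field_simps)
  qed
  moreover have "eventually (\<lambda>x. (2 + S) * J / \<eta> \<le> \<bar>ln (b x)\<bar>) F"
    using lim by (auto simp: filterlim_at_top)
  ultimately show ?thesis using Cpos
  proof eventually_elim
    case (elim x)
    define l where "l = \<bar>ln (b x)\<bar>"
    define N where "N = nat \<lceil>(1 + \<eta>) * l / r\<rceil>"
    have l0: "0 \<le> l" by (simp add: l_def)
    have N: "(1 + \<eta>) * l / r \<le> real N" unfolding N_def by linarith
    have N': "real N \<le> (1 + \<eta>) * l / r + 1"
    proof -
      have "0 \<le> (1 + \<eta>) * l / r" using l0 r \<eta> by simp
      then show ?thesis unfolding N_def by linarith
    qed
    have "expected_time P (T_null M (C x)) \<le> ennreal (real (Suc N) + S)"
    proof (rule S(1))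
      fix e assume e: "e \<in> units M"
      have "ln (C x e) \<le> (1 + \<eta>) * l" using elim(1) e by (simp add: l_def)
      also have "\<dots> \<le> real N * r" using N r by (simp add: field_simps)
      finally show "0 < C x e \<and> ln (C x e) \<le> real N * r" using elim(3) e by simp
    qed
    also have "real (Suc N) + S \<le> (1 + \<epsilon>) * (l / J)"
    proof -
      have "2 + S \<le> \<eta> * (l / J)"
        using elim(2) J \<eta> by (simp add: l_def field_simps)
      moreover have "real (Suc N) \<le> (1 + \<eta>)\<^sup>2 * (l / J) + 2"
        using N' J \<eta> by (simp add: r_def power2_eq_square mult_ac)
      moreover have "(1 + \<eta>)\<^sup>2 + \<eta> \<le> 1 + \<epsilon>"
      proof -
        have "\<eta> * \<eta> \<le> \<eta> * 1" using \<eta> by (intro mult_left_mono) auto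
        moreover have "\<epsilon> = 8 * \<eta>" by (simp add: \<eta>_def)
        ultimately show ?thesis using \<eta> by (simp add: power2_eq_square algebra_simps)
      qed
      then have "((1 + \<eta>)\<^sup>2 + \<eta>) * (l / J) \<le> (1 + \<epsilon>) * (l / J)"
        using l0 J by (intro mult_right_mono) auto
      ultimately show ?thesis by (simp add: algebra_simps)
    qed
    finally show ?case by (simp add: l_def ennreal_leI)
  qed
qed

text \<open>
  All three claims of the theorem are instances of this one, with \<open>a\<close> and \<open>b\<close> the two levels that
  control false alarms and missed detections.  What matters is that the class consists of
  detection tests with these levels, and that the procedure belongs to it and stops no later than the
  null rule: the lower bound then holds for the infimum over the class and the upper bound for the
  procedure, and the infimum lies below the expectation of the procedure.
\<close>

lemma first_order_optimality:
  fixes M :: "'x setting" and a b :: "'b \<Rightarrow> real" and C :: "'b \<Rightarrow> thresholds"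
  assumes valid: "valid_setting M"
    and conditions: "info_positive M I" "condition_M M I" "condition_CC M I"
    and P: "P \<in> H_null M"
    and subsystems: "Min ((\<lambda>e. min_info M I P (G_Psi M e) (sdet M e)) ` units M) =
                     Min ((\<lambda>e. min_info M I P (G_Psi M e) (sources M)) ` units M)"
    and a: "filterlim a (at_right 0) F" and b: "filterlim b (at_right 0) F"
    and Cpos: "eventually (\<lambda>x. \<forall>e\<in>units M. 0 < C x e) F"
    and Casym: "\<And>e. e \<in> units M \<Longrightarrow> (\<lambda>x. ln (C x e)) \<sim>[F] (\<lambda>x. \<bar>ln (b x)\<bar>)"
    and cls: "eventually (\<lambda>x. cls x \<subseteq> class_D M (a x) (b x)) F"
    and mem: "eventually (\<lambda>x. (T x, d x) \<in> cls x) F"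
    and le: "\<And>x y. T x y \<le> T_null M (C x) y"
  shows "(\<lambda>x. ET P (T x)) \<sim>[F] (\<lambda>x. max_ratio M I P (b x)) \<and>
    (\<lambda>x. max_ratio M I P (b x)) \<sim>[F] (\<lambda>x. optimal_ET P (cls x))"
proof -
  let ?i = "\<lambda>e. min_info M I P (G_Psi M e) (sources M)"
  define J where "J = Min (?i ` units M)"
  define L where "L x = \<bar>ln (b x)\<bar> / J" for x
  note U = valid_settingD(2,3)[OF valid]
  have "J \<in> ?i ` units M" unfolding J_def using U by (intro Min_in) auto
  then obtain e0 where e0: "e0 \<in> units M" "J = ?i e0" by auto
  have pos: "0 < ?i e" if "e \<in> units M" for e
    by (rule min_info_pos[OF valid conditions(1) P that])
  have J: "0 < J" using pos[OF e0(1)] e0 by simp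
  have mr: "max_ratio M I P (b x) = L x" for x
    unfolding max_ratio_def
  proof (rule Max_eqI)
    show "L x \<in> (\<lambda>e. \<bar>ln (b x)\<bar> / ?i e) ` units M" using e0 by (auto simp: L_def)
    fix y assume "y \<in> (\<lambda>e. \<bar>ln (b x)\<bar> / ?i e) ` units M"
    then obtain e where e: "e \<in> units M" "y = \<bar>ln (b x)\<bar> / ?i e" by auto
    have "J \<le> ?i e" unfolding J_def using U e by (intro Min_le) auto
    then show "y \<le> L x" unfolding e L_def using J by (intro divide_left_mono) (auto intro: pos e)
  qed (use U in simp)
  have L0: "0 \<le> L x" for x using J by (simp add: L_def)
  have Lpos: "eventually (\<lambda>x. 0 < L x) F"
  proof -
    have "eventually (\<lambda>x. 0 < \<bar>ln (b x)\<bar>) F"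
      using filterlim_abs_ln_at_top[OF b] unfolding filterlim_at_top_dense by blast
    then show ?thesis by eventually_elim (use J in \<open>simp add: L_def\<close>)
  qed
  let ?opt = "\<lambda>x. (INF (T, d)\<in>cls x. expected_time P T)"
  have opt_le: "eventually (\<lambda>x. ?opt x \<le> expected_time P (T x)) F"
    using mem by eventually_elim (auto intro: INF_lower2)
  have lower: "eventually (\<lambda>x. ennreal ((1 - \<epsilon>) * L x) \<le> ?opt x) F" if "0 < \<epsilon>" "\<epsilon> < 1" for \<epsilon>
    using class_D_expected_time_lower[OF valid conditions(1,2) P a b that] cls
    by eventually_elim (auto simp: L_def J_def intro!: INF_greatest)
  have upper: "eventually (\<lambda>x. expected_time P (T x) \<le> ennreal ((1 + \<epsilon>) * L x)) F"
    if "0 < \<epsilon>" "\<epsilon> < 1" for \<epsilon>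
  proof -
    have "eventually (\<lambda>x. expected_time P (T_null M (C x)) \<le> ennreal ((1 + \<epsilon>) * L x)) F"
      unfolding L_def J_def subsystems[symmetric]
      by (rule null_time_expected_upper[OF valid conditions(3) P b Cpos Casym that])
        (use J in \<open>simp_all add: subsystems J_def\<close>)
    then show ?thesis
    proof eventually_elim
      case (elim x)
      have "expected_time P (T x) \<le> expected_time P (T_null M (C x))"
        unfolding expected_time_def by (intro nn_integral_mono) (simp add: le)
      also note elim
      finally show ?case .
    qed
  qed
  have ET: "(\<lambda>x. ET P (T x)) \<sim>[F] L"
  proof (rule asymp_equiv_if_eventually_close[OF Lpos])
    fix \<epsilon> :: real assume \<epsilon>: "0 < \<epsilon>" "\<epsilon> < 1"
    show "eventually (\<lambda>x. (1 - \<epsilon>) * L x \<le> ET P (T x)) F"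
      using lower[OF \<epsilon>] upper[OF \<epsilon>] opt_le
    proof eventually_elim
      case (elim x)
      have "enn2real (ennreal ((1 - \<epsilon>) * L x)) \<le> ET P (T x)"
        unfolding ET_def using elim by (intro enn2real_mono) (auto intro: order_trans le_less_trans)
      then show ?case using L0[of x] \<epsilon> by simp
    qed
    show "eventually (\<lambda>x. ET P (T x) \<le> (1 + \<epsilon>) * L x) F"
      using upper[OF \<epsilon>]
    proof eventually_elim
      case (elim x)
      then have "ET P (T x) \<le> enn2real (ennreal ((1 + \<epsilon>) * L x))"
        unfolding ET_def by (intro enn2real_mono) auto
      then show ?case using L0[of x] \<epsilon> by simp
    qed
  qed
  have opt: "(\<lambda>x. optimal_ET P (cls x)) \<sim>[F] L"
  proof (rule asymp_equiv_if_eventually_close[OF Lpos])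
    fix \<epsilon> :: real assume \<epsilon>: "0 < \<epsilon>" "\<epsilon> < 1"
    show "eventually (\<lambda>x. (1 - \<epsilon>) * L x \<le> optimal_ET P (cls x)) F"
      using lower[OF \<epsilon>] upper[OF \<epsilon>] opt_le
    proof eventually_elim
      case (elim x)
      have "?opt x < \<top>"
        using order_trans[OF elim(3,2)] ennreal_less_top by (rule le_less_trans)
      then have "enn2real (ennreal ((1 - \<epsilon>) * L x)) \<le> optimal_ET P (cls x)"
        unfolding optimal_ET_def using elim(1) by (intro enn2real_mono)
      then show ?case using L0[of x] \<epsilon> by simp
    qed
    show "eventually (\<lambda>x. optimal_ET P (cls x) \<le> (1 + \<epsilon>) * L x) F"
      using upper[OF \<epsilon>] opt_le
    proof eventually_elim
      case (elim x)
      then have "optimal_ET P (cls x) \<le> enn2real (ennreal ((1 + \<epsilon>) * L x))"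
        unfolding optimal_ET_def by (intro enn2real_mono) (auto intro: order_trans)
      then show ?case using L0[of x] \<epsilon> by simp
    qed
  qed
  show ?thesis unfolding mr using ET opt asymp_equiv_sym by blast
qed

section \<open>The three procedures\<close>

lemma class_C_subset_class_D: "class_C M \<alpha> \<beta> \<gamma> \<delta> \<subseteq> class_D M \<alpha> \<beta>"
  by (auto simp: class_C_def)

text \<open>
  Under a null distribution a nonempty decision is a false positive, and under any other
  distribution in \<open>P_Psi M\<close> an empty decision misses an anomaly.  So the familywise levels \<open>\<gamma>\<close>, \<open>\<delta>\<close> take the roles of the detection
  levels.
\<close>

lemma class_E_subset_class_D:
  assumes valid: "valid_setting M" and empty: "{} \<in> Psi M"
  shows "class_E M \<gamma> \<delta> \<subseteq> class_D M \<gamma> \<delta>"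
proof clarify
  fix T d assume E: "(T, d) \<in> class_E M \<gamma> \<delta>"
  then have test: "is_test M (T, d)" by (simp add: class_E_def)
  show "(T, d) \<in> class_D M \<gamma> \<delta>"
    unfolding class_D_def
  proof (intro CollectI case_prodI conjI ballI test)
    fix R assume R: "R \<in> H_null M"
    have "measure R {x \<in> space R. d x - anomalous M R \<noteq> {}} \<le> \<gamma>"
      using E R H_null_subset_P_Psi[OF valid empty] by (auto simp: class_E_def)
    then show "measure R {x \<in> space R. d x \<noteq> {}} \<le> \<gamma>"
      using anomalous_null[OF valid R] by simp
  next
    fix R assume R: "R \<in> P_Psi M - H_null M"
    have Rd: "R \<in> dists M" using R distribution_families_subset by blast
    interpret prob_space R using valid_settingD(4)[OF valid Rd] .
    have sR: "sets R = sets (full_space M)"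
      using valid_settingD(5)[OF valid Rd] by (simp add: full_space_def)
    have "{x \<in> space R. anomalous M R - d x \<noteq> {}} \<in> sets R"
      using test_decision_measurable[OF test, of "{D. anomalous M R - D \<noteq> {}}"] sR
        sets_eq_imp_space_eq[OF sR] by simp
    then have "measure R {x \<in> space R. d x = {}} \<le> measure R {x \<in> space R. anomalous M R - d x \<noteq> {}}"
      using anomalous_nonempty[OF R] by (intro finite_measure_mono) auto
    also have "\<dots> \<le> \<delta>" using E R by (auto simp: class_E_def)
    finally show "measure R {x \<in> space R. d x = {}} \<le> \<delta>" .
  qed
qed

lemma eventually_level_regime:
  "level_regime F \<Longrightarrow> eventually (\<lambda>c. c \<in> {0<..<1}) F"
  using eventually_at_right_0_unit[OF filterlim_ident] by (auto simp: level_regime_def eventually_principal)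

theorem theorem4p4:
  fixes M :: "'x setting"
    and I :: "'x path measure \<Rightarrow> 'x path measure \<Rightarrow> real"
    and P :: "'x path measure"
    and C1 D1 :: "real \<Rightarrow> real \<Rightarrow> thresholds"
    and A B C D :: "real \<Rightarrow> real \<Rightarrow> real \<Rightarrow> real \<Rightarrow> thresholds"
    and A2 B2 :: "real \<Rightarrow> real \<Rightarrow> thresholds"
    and d_det d_fwer :: "real \<Rightarrow> real \<Rightarrow> 'x path \<Rightarrow> nat set set"
    and d_star :: "real \<Rightarrow> real \<Rightarrow> real \<Rightarrow> real \<Rightarrow> 'x path \<Rightarrow> nat set set"
    and F\<gamma> F\<delta> :: "real filter"
  assumes setting: "valid_setting M"
    and conditions: "info_positive M I" "condition_M M I" "condition_CC M I"
    and empty_in_Psi: "{} \<in> Psi M"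
    and P_null: "P \<in> H_null M"
    and subsystems: "Min ((\<lambda>e. min_info M I P (G_Psi M e) (sdet M e)) ` units M) =
                     Min ((\<lambda>e. min_info M I P (G_Psi M e) (sources M)) ` units M)"
    and regimes: "level_regime F\<gamma>" "level_regime F\<delta>"
    \<comment> \<open>thresholds and decisions of the detection procedure, as functions of \<open>\<alpha>\<close>, \<open>\<beta>\<close>\<close>
    and det_pos: "\<And>\<alpha> \<beta> e. \<lbrakk>\<alpha> \<in> {0<..<1}; \<beta> \<in> {0<..<1}; e \<in> units M\<rbrakk> \<Longrightarrow> C1 \<alpha> \<beta> e > 0 \<and> D1 \<alpha> \<beta> e > 0"
    and det_decision: "\<And>\<alpha> \<beta>. \<lbrakk>\<alpha> \<in> {0<..<1}; \<beta> \<in> {0<..<1}\<rbrakk> \<Longrightarrow>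
          is_det_decision M (C1 \<alpha> \<beta>) (D1 \<alpha> \<beta>) (d_det \<alpha> \<beta>)"
    and det_class: "\<And>\<alpha> \<beta>. \<lbrakk>\<alpha> \<in> {0<..<1}; \<beta> \<in> {0<..<1}\<rbrakk> \<Longrightarrow>
          (T_det_star M (C1 \<alpha> \<beta>) (D1 \<alpha> \<beta>), d_det \<alpha> \<beta>) \<in> class_D M \<alpha> \<beta>"
    and det_thresholds: "\<And>e. e \<in> units M \<Longrightarrow>
          ((\<lambda>(\<alpha>, \<beta>). ln (C1 \<alpha> \<beta> e)) \<sim>[levels2] (\<lambda>(\<alpha>, \<beta>). \<bar>ln \<beta>\<bar>)) \<and>
          ((\<lambda>(\<alpha>, \<beta>). ln (D1 \<alpha> \<beta> e)) \<sim>[levels2] (\<lambda>(\<alpha>, \<beta>). \<bar>ln \<alpha>\<bar>))"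
    \<comment> \<open>thresholds and decisions of the joint procedure, as functions of \<open>\<alpha>\<close>, \<open>\<beta>\<close>, \<open>\<gamma>\<close>, \<open>\<delta>\<close>\<close>
    and joint_pos: "\<And>\<alpha> \<beta> \<gamma> \<delta> e.
          \<lbrakk>\<alpha> \<in> {0<..<1}; \<beta> \<in> {0<..<1}; \<gamma> \<in> {0<..<1}; \<delta> \<in> {0<..<1}; e \<in> units M\<rbrakk> \<Longrightarrow>
          A \<alpha> \<beta> \<gamma> \<delta> e > 0 \<and> B \<alpha> \<beta> \<gamma> \<delta> e > 0 \<and> C \<alpha> \<beta> \<gamma> \<delta> e > 0 \<and> D \<alpha> \<beta> \<gamma> \<delta> e > 0"
    and joint_decision: "\<And>\<alpha> \<beta> \<gamma> \<delta>.
          \<lbrakk>\<alpha> \<in> {0<..<1}; \<beta> \<in> {0<..<1}; \<gamma> \<in> {0<..<1}; \<delta> \<in> {0<..<1}\<rbrakk> \<Longrightarrow>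
          is_joint_decision M (A \<alpha> \<beta> \<gamma> \<delta>) (B \<alpha> \<beta> \<gamma> \<delta>) (C \<alpha> \<beta> \<gamma> \<delta>) (D \<alpha> \<beta> \<gamma> \<delta>) (d_star \<alpha> \<beta> \<gamma> \<delta>)"
    and joint_class: "\<And>\<alpha> \<beta> \<gamma> \<delta>.
          \<lbrakk>\<alpha> \<in> {0<..<1}; \<beta> \<in> {0<..<1}; \<gamma> \<in> {0<..<1}; \<delta> \<in> {0<..<1}\<rbrakk> \<Longrightarrow>
          (T_star M (A \<alpha> \<beta> \<gamma> \<delta>) (B \<alpha> \<beta> \<gamma> \<delta>) (C \<alpha> \<beta> \<gamma> \<delta>) (D \<alpha> \<beta> \<gamma> \<delta>), d_star \<alpha> \<beta> \<gamma> \<delta>)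
            \<in> class_C M \<alpha> \<beta> \<gamma> \<delta>"
    and joint_thresholds: "\<And>e. e \<in> units M \<Longrightarrow>
          ((\<lambda>(\<alpha>, \<beta>, \<gamma>, \<delta>). ln (C \<alpha> \<beta> \<gamma> \<delta> e)) \<sim>[levels4 F\<gamma> F\<delta>] (\<lambda>(\<alpha>, \<beta>, \<gamma>, \<delta>). \<bar>ln \<beta>\<bar>)) \<and>
          ((\<lambda>(\<alpha>, \<beta>, \<gamma>, \<delta>). ln (D \<alpha> \<beta> \<gamma> \<delta> e)) \<sim>[levels4 F\<gamma> F\<delta>] (\<lambda>(\<alpha>, \<beta>, \<gamma>, \<delta>). \<bar>ln \<alpha>\<bar>)) \<and>
          (F\<delta> = at_right 0 \<longrightarrow>
            ((\<lambda>(\<alpha>, \<beta>, \<gamma>, \<delta>). ln (A \<alpha> \<beta> \<gamma> \<delta> e)) \<sim>[levels4 F\<gamma> F\<delta>] (\<lambda>(\<alpha>, \<beta>, \<gamma>, \<delta>). \<bar>ln \<delta>\<bar>))) \<and>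
          (F\<gamma> = at_right 0 \<longrightarrow>
            ((\<lambda>(\<alpha>, \<beta>, \<gamma>, \<delta>). ln (B \<alpha> \<beta> \<gamma> \<delta> e)) \<sim>[levels4 F\<gamma> F\<delta>] (\<lambda>(\<alpha>, \<beta>, \<gamma>, \<delta>). \<bar>ln \<gamma>\<bar>)))"
    \<comment> \<open>the same for the procedure with \<open>C = A\<close>, \<open>D = B\<close>, as functions of \<open>\<gamma>\<close>, \<open>\<delta>\<close>\<close>
    and fwer_pos: "\<And>\<gamma> \<delta> e. \<lbrakk>\<gamma> \<in> {0<..<1}; \<delta> \<in> {0<..<1}; e \<in> units M\<rbrakk> \<Longrightarrow> A2 \<gamma> \<delta> e > 0 \<and> B2 \<gamma> \<delta> e > 0"
    and fwer_decision: "\<And>\<gamma> \<delta>. \<lbrakk>\<gamma> \<in> {0<..<1}; \<delta> \<in> {0<..<1}\<rbrakk> \<Longrightarrow>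
          is_joint_decision M (A2 \<gamma> \<delta>) (B2 \<gamma> \<delta>) (A2 \<gamma> \<delta>) (B2 \<gamma> \<delta>) (d_fwer \<gamma> \<delta>)"
    and fwer_class: "\<And>\<gamma> \<delta>. \<lbrakk>\<gamma> \<in> {0<..<1}; \<delta> \<in> {0<..<1}\<rbrakk> \<Longrightarrow>
          (T_star M (A2 \<gamma> \<delta>) (B2 \<gamma> \<delta>) (A2 \<gamma> \<delta>) (B2 \<gamma> \<delta>), d_fwer \<gamma> \<delta>) \<in> class_E M \<gamma> \<delta>"
    and fwer_thresholds: "\<And>e. e \<in> units M \<Longrightarrow>
          ((\<lambda>(\<gamma>, \<delta>). ln (A2 \<gamma> \<delta> e)) \<sim>[levels2] (\<lambda>(\<gamma>, \<delta>). \<bar>ln \<delta>\<bar>)) \<and>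
          ((\<lambda>(\<gamma>, \<delta>). ln (B2 \<gamma> \<delta> e)) \<sim>[levels2] (\<lambda>(\<gamma>, \<delta>). \<bar>ln \<gamma>\<bar>))"
  shows
    "((\<lambda>(\<alpha>, \<beta>). ET P (T_det_star M (C1 \<alpha> \<beta>) (D1 \<alpha> \<beta>))) \<sim>[levels2] (\<lambda>(\<alpha>, \<beta>). max_ratio M I P \<beta>)) \<and>
     ((\<lambda>(\<alpha>, \<beta>). max_ratio M I P \<beta>) \<sim>[levels2] (\<lambda>(\<alpha>, \<beta>). optimal_ET P (class_D M \<alpha> \<beta>))) \<and>
     ((\<lambda>(\<alpha>, \<beta>, \<gamma>, \<delta>). ET P (T_star M (A \<alpha> \<beta> \<gamma> \<delta>) (B \<alpha> \<beta> \<gamma> \<delta>) (C \<alpha> \<beta> \<gamma> \<delta>) (D \<alpha> \<beta> \<gamma> \<delta>)))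
        \<sim>[levels4 F\<gamma> F\<delta>] (\<lambda>(\<alpha>, \<beta>, \<gamma>, \<delta>). max_ratio M I P \<beta>)) \<and>
     ((\<lambda>(\<alpha>, \<beta>, \<gamma>, \<delta>). max_ratio M I P \<beta>) \<sim>[levels4 F\<gamma> F\<delta>] (\<lambda>(\<alpha>, \<beta>, \<gamma>, \<delta>). optimal_ET P (class_C M \<alpha> \<beta> \<gamma> \<delta>))) \<and>
     ((\<lambda>(\<gamma>, \<delta>). ET P (T_star M (A2 \<gamma> \<delta>) (B2 \<gamma> \<delta>) (A2 \<gamma> \<delta>) (B2 \<gamma> \<delta>))) \<sim>[levels2] (\<lambda>(\<gamma>, \<delta>). max_ratio M I P \<delta>)) \<and>
     ((\<lambda>(\<gamma>, \<delta>). max_ratio M I P \<delta>) \<sim>[levels2] (\<lambda>(\<gamma>, \<delta>). optimal_ET P (class_E M \<gamma> \<delta>)))"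
proof (intro conjI)
  have levels2: "filterlim fst (at_right 0) levels2" "filterlim snd (at_right 0) levels2"
    by (rule filterlim_fst filterlim_snd)+
  have unit2: "eventually (\<lambda>x. fst x \<in> {0<..<1} \<and> snd x \<in> {0<..<1}) levels2"
    using levels2[THEN eventually_at_right_0_unit] by (rule eventually_conj)
  let ?F = "levels4 F\<gamma> F\<delta>"
  have levels4: "filterlim fst (at_right 0) ?F" "filterlim (\<lambda>x. fst (snd x)) (at_right 0) ?F"
    "filterlim (\<lambda>x. fst (snd (snd x))) F\<gamma> ?F" "filterlim (\<lambda>x. snd (snd (snd x))) F\<delta> ?F"
    by (rule filterlim_fst filterlim_snd filterlim_compose[OF filterlim_fst filterlim_snd]
        filterlim_compose[OF filterlim_fst filterlim_compose[OF filterlim_snd filterlim_snd]]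
        filterlim_compose[OF filterlim_snd filterlim_compose[OF filterlim_snd filterlim_snd]])+
  have unit4: "eventually (\<lambda>x. fst x \<in> {0<..<1} \<and> fst (snd x) \<in> {0<..<1} \<and>
      fst (snd (snd x)) \<in> {0<..<1} \<and> snd (snd (snd x)) \<in> {0<..<1}) ?F"
    using levels4(1,2)[THEN eventually_at_right_0_unit]
      filterlim_iff[THEN iffD1, rule_format, OF levels4(3) eventually_level_regime[OF regimes(1)]]
      filterlim_iff[THEN iffD1, rule_format, OF levels4(4) eventually_level_regime[OF regimes(2)]]
    by (intro eventually_conj)
  note optimality = first_order_optimality[OF setting conditions P_null subsystems]
  have det: "(\<lambda>x. ET P (T_det_star M (C1 (fst x) (snd x)) (D1 (fst x) (snd x))))
        \<sim>[levels2] (\<lambda>x. max_ratio M I P (snd x)) \<and>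
      (\<lambda>x. max_ratio M I P (snd x)) \<sim>[levels2] (\<lambda>x. optimal_ET P (class_D M (fst x) (snd x)))"
  proof (rule optimality[OF levels2])
    show "eventually (\<lambda>x. \<forall>e\<in>units M. 0 < C1 (fst x) (snd x) e) levels2"
      using unit2 by eventually_elim (use det_pos in blast)
    show "eventually (\<lambda>x. (T_det_star M (C1 (fst x) (snd x)) (D1 (fst x) (snd x)), d_det (fst x) (snd x))
        \<in> class_D M (fst x) (snd x)) levels2"
      using unit2 by eventually_elim (use det_class in blast)
  qed (use det_thresholds in \<open>simp_all add: case_prod_unfold T_det_star_def\<close>)
  then show "(\<lambda>(\<alpha>, \<beta>). ET P (T_det_star M (C1 \<alpha> \<beta>) (D1 \<alpha> \<beta>))) \<sim>[levels2] (\<lambda>(\<alpha>, \<beta>). max_ratio M I P \<beta>)"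
    "(\<lambda>(\<alpha>, \<beta>). max_ratio M I P \<beta>) \<sim>[levels2] (\<lambda>(\<alpha>, \<beta>). optimal_ET P (class_D M \<alpha> \<beta>))"
    by (simp_all add: case_prod_unfold)
  let ?at = "\<lambda>f x. f (fst x) (fst (snd x)) (fst (snd (snd x))) (snd (snd (snd x)))"
  have joint: "(\<lambda>x. ET P (T_star M (?at A x) (?at B x) (?at C x) (?at D x)))
        \<sim>[?F] (\<lambda>x. max_ratio M I P (fst (snd x))) \<and>
      (\<lambda>x. max_ratio M I P (fst (snd x))) \<sim>[?F] (\<lambda>x. optimal_ET P (?at (class_C M) x))"
  proof (rule optimality[OF levels4(1,2)])
    show "eventually (\<lambda>x. \<forall>e\<in>units M. 0 < ?at C x e) ?F"
      using unit4 by eventually_elim (use joint_pos in blast)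
    show "eventually (\<lambda>x. (T_star M (?at A x) (?at B x) (?at C x) (?at D x), ?at d_star x)
        \<in> ?at (class_C M) x) ?F"
      using unit4 by eventually_elim (use joint_class in blast)
  qed (use joint_thresholds in \<open>simp_all add: case_prod_unfold T_star_def class_C_subset_class_D\<close>)
  then show "(\<lambda>(\<alpha>, \<beta>, \<gamma>, \<delta>). ET P (T_star M (A \<alpha> \<beta> \<gamma> \<delta>) (B \<alpha> \<beta> \<gamma> \<delta>) (C \<alpha> \<beta> \<gamma> \<delta>) (D \<alpha> \<beta> \<gamma> \<delta>)))
        \<sim>[?F] (\<lambda>(\<alpha>, \<beta>, \<gamma>, \<delta>). max_ratio M I P \<beta>)"
    "(\<lambda>(\<alpha>, \<beta>, \<gamma>, \<delta>). max_ratio M I P \<beta>) \<sim>[?F] (\<lambda>(\<alpha>, \<beta>, \<gamma>, \<delta>). optimal_ET P (class_C M \<alpha> \<beta> \<gamma> \<delta>))"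
    by (simp_all add: case_prod_unfold)
  have fwer: "(\<lambda>x. ET P (T_star M (A2 (fst x) (snd x)) (B2 (fst x) (snd x)) (A2 (fst x) (snd x)) (B2 (fst x) (snd x))))
        \<sim>[levels2] (\<lambda>x. max_ratio M I P (snd x)) \<and>
      (\<lambda>x. max_ratio M I P (snd x)) \<sim>[levels2] (\<lambda>x. optimal_ET P (class_E M (fst x) (snd x)))"
  proof (rule optimality[OF levels2])
    show "eventually (\<lambda>x. \<forall>e\<in>units M. 0 < A2 (fst x) (snd x) e) levels2"
      using unit2 by eventually_elim (use fwer_pos in blast)
    show "eventually (\<lambda>x. (T_star M (A2 (fst x) (snd x)) (B2 (fst x) (snd x)) (A2 (fst x) (snd x)) (B2 (fst x) (snd x)),
        d_fwer (fst x) (snd x)) \<in> class_E M (fst x) (snd x)) levels2"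
      using unit2 by eventually_elim (use fwer_class in blast)
  qed (use fwer_thresholds class_E_subset_class_D[OF setting empty_in_Psi] in
      \<open>simp_all add: case_prod_unfold T_star_def\<close>)
  then show "(\<lambda>(\<gamma>, \<delta>). ET P (T_star M (A2 \<gamma> \<delta>) (B2 \<gamma> \<delta>) (A2 \<gamma> \<delta>) (B2 \<gamma> \<delta>))) \<sim>[levels2] (\<lambda>(\<gamma>, \<delta>). max_ratio M I P \<delta>)"
    "(\<lambda>(\<gamma>, \<delta>). max_ratio M I P \<delta>) \<sim>[levels2] (\<lambda>(\<gamma>, \<delta>). optimal_ET P (class_E M \<gamma> \<delta>))"
    by (simp_all add: case_prod_unfold)
qed

end
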